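(* Let $V=(A_1,A_2,H,\Phi,E,\sigma_1,\sigma_2,\gamma^{in},\gamma^{out})$ be a two-operator commutative vessel with irreducible discriminant polynomial, and let $r_1=p_1/p_0$, $r_2=p_2/p_0$, where $p_0,p_1,p_2$ are real polynomials in two variables, be such that $A'_1=r_1(A_1,A_2)$ and $A'_2=r_2(A_1,A_2)$ are defined (that is, $p_0(A_1,A_2)$ is invertible and $A'_i=p_0(A_1,A_2)^{-1}p_i(A_1,A_2)$). Define $E',\Phi',\sigma'_1,\sigma'_2,\gamma'^{in},\gamma'^{out}$ as in the context. Then $$V'=(A'_1,A'_2,H,\Phi',E',\sigma'_1,\sigma'_2,\gamma'^{in},\gamma'^{out})$$ is a commutative vessel.
   Context: **Vessels.** Let $H$ be a Hilbert space (finite- or infinite-dimensional) and $E$ a finite-dimensional Hilbert space. A two-operator commutative vessel is a collection $V=(A_1,A_2,H,\Phi,E,\sigma_1,\sigma_2,\gamma^{in},\gamma^{out})$, where $A_1,A_2$ are commuting bounded linear operators on $H$, $\Phi:H\to E$ is a bounded linear map with adjoint $\Phi^*:E\to H$, and $\sigma_1,\sigma_2,\gamma^{in},\gamma^{out}$ are bounded selfadjoint operators on $E$, such that $$\Phi^*\sigma_k\Phi=\tfrac1i(A_k-A_k^* )\quad(k=1,2),$$ $$\gamma^{in}\Phi=\sigma_1\Phi A_2^*-\sigma_2\Phi A_1^*,\qquad \gamma^{out}\Phi=\sigma_1\Phi A_2-\sigma_2\Phi A_1,$$ $$\gamma^{out}=\gamma^{in}+i(\sigma_1\Phi\Phi^*\sigma_2-\sigma_2\Phi\Phi^*\sigma_1).$$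 Its discriminant polynomial is $\Delta(y_1,y_2)=\det(y_1\sigma_2-y_2\sigma_1+\gamma^{in})$, and it equals $\det(y_1\sigma_2-y_2\sigma_1+\gamma^{out})$. Put $m=\dim E$, identify $E$ with $\mathbb{C}^m$, and put $\Delta(x_0,x_1,x_2)=\det(x_0\gamma^{in}+x_1\sigma_2-x_2\sigma_1)$, a homogeneous polynomial of degree $m$. It is assumed that $\Delta$ is irreducible (both as a polynomial in $y_1,y_2$ and as a homogeneous polynomial in $x_0,x_1,x_2$). **Homogenization.** Let $n$ be the maximal degree of $p_0,p_1,p_2$, and let $P_k(x_0,x_1,x_2)=x_0^n p_k(x_1/x_0,x_2/x_0)$ be the homogenization of $p_k$ to degree $n$. **Principal subspace.** Let $W_n=\mathbb{C}^{m\,n(n+1)/2}$, whose elements are written $w=(w_{i_1,i_2})_{i_1,i_2\ge 0,\ i_1+i_2\le n-1}$ with $w_{i_1,i_2}\in\mathbb{C}^m=E$. Equivalently the index is $i=(i_0,i_1,i_2)$ with $|i|=i_0+i_1+i_2=n-1$. The principal subspace is $$V_n=\{w\in W_n:\ \sigma_2w_{i_1+1,i_2}-\sigma_1w_{i_1,i_2+1}+\gamma^{in}w_{i_1,i_2}=0\ \text{ for all } i_1,i_2\ge0,\ i_1+i_2\le n-2\}.$$ **Generalized Bezout matrices.** For homogeneous polynomials $p,q$ of degree $n$ in three variables there exist symmetric $\frac{n(n+1)}2\times\frac{n(n+1)}2$ matrices $\beta^{10}=(b^{10}_{ij})$, $\beta^{20}=(b^{20}_{ij})$, $\beta^{12}=(b^{12}_{ij})$,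 indexed by multi-indices $i,j$ with $|i|=|j|=n-1$, such that $$p(x)q(y)-q(x)p(y)=\sum_{|i|=|j|=n-1}\Big[b^{10}_{ij}x^i(x_1y_0-x_0y_1)y^j+b^{20}_{ij}x^i(x_2y_0-x_0y_2)y^j+b^{12}_{ij}x^i(x_1y_2-x_2y_1)y^j\Big].$$ Put $B(p,q)=\beta^{12}\otimes\gamma^{in}+\beta^{10}\otimes\sigma_1+\beta^{20}\otimes\sigma_2$ on $W_n$, and let $B'(p,q)=\mathcal{P}_{V_n}B(p,q)\mathcal{P}_{V_n}$, regarded as an operator on $V_n$, where $\mathcal{P}_{V_n}$ is the orthogonal projection of $W_n$ onto $V_n$. **The transformed data.** $$E'=V_n,\qquad \Phi'=\mathcal{P}_{E'}\big(\Phi A_1^{*i_1}A_2^{*i_2}\,p_0(A_1^*,A_2^* )^{-1}\big)_{i_1+i_2\le n-1}:H\to E',$$ $$\sigma'_1=B'(P_1,P_0),\quad \sigma'_2=B'(P_2,P_0),\quad \gamma'^{in}=B'(P_1,P_2),$$ $$\gamma'^{out}=\gamma'^{in}+i(\sigma'_1\Phi'\Phi'^*\sigma'_2-\sigma'_2\Phi'\Phi'^*\sigma'_1).$$ *)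

theory Defs
  imports
    "HOL-Analysis.Analysis"
    "HOL-Library.Poly_Mapping"
    "HOL-Computational_Algebra.Factorial_Ring"
begin

section \<open>Complex inner product spaces and operators\<close>

class complex_vector = ab_group_add +
  fixes scaleC :: "complex \<Rightarrow> 'a \<Rightarrow> 'a" (infixr "*\<^sub>C" 75)
  assumes scaleC_add_right: "a *\<^sub>C (x + y) = a *\<^sub>C x + a *\<^sub>C y"
    and scaleC_add_left: "(a + b) *\<^sub>C x = a *\<^sub>C x + b *\<^sub>C x"
    and scaleC_scaleC: "a *\<^sub>C b *\<^sub>C x = (a * b) *\<^sub>C x"
    and scaleC_one: "1 *\<^sub>C x = x"

global_interpretation complex_vector:
  vector_space "scaleC :: complex \<Rightarrow> 'a \<Rightarrow> 'a :: complex_vector"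
  by unfold_locales
    (simp_all add: scaleC_add_right scaleC_add_left scaleC_scaleC scaleC_one)

text \<open>The inner product is linear in its first argument.\<close>

class complex_inner = complex_vector +
  fixes cinner :: "'a \<Rightarrow> 'a \<Rightarrow> complex"
  assumes cinner_commute: "cinner x y = cnj (cinner y x)"
    and cinner_add_left: "cinner (x + y) z = cinner x z + cinner y z"
    and cinner_scaleC_left: "cinner (a *\<^sub>C x) y = a * cinner x y"
    and cinner_ge_zero: "0 \<le> Re (cinner x x)"
    and cinner_eq_zero_iff: "cinner x x = 0 \<longleftrightarrow> x = 0"

definition cnorm :: "'a::complex_inner \<Rightarrow> real" where
  "cnorm x = sqrt (Re (cinner x x))"

class complex_hilbert = banach + complex_inner +
  assumes norm_eq_sqrt_cinner: "norm x = sqrt (Re (cinner x x))"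
    and scaleR_eq_scaleC: "r *\<^sub>R x = complex_of_real r *\<^sub>C x"

instantiation complex :: complex_hilbert
begin

definition scaleC_complex :: "complex \<Rightarrow> complex \<Rightarrow> complex" where
  "scaleC_complex a x = a * x"

definition cinner_complex :: "complex \<Rightarrow> complex \<Rightarrow> complex" where
  "cinner_complex x y = x * cnj y"

instance
proof
  fix a b x y z :: complex and r :: real
  show "a *\<^sub>C (x + y) = a *\<^sub>C x + a *\<^sub>C y" "(a + b) *\<^sub>C x = a *\<^sub>C x + b *\<^sub>C x"
    "a *\<^sub>C b *\<^sub>C x = (a * b) *\<^sub>C x" "1 *\<^sub>C x = x"
    by (simp_all add: scaleC_complex_def algebra_simps)
  show "cinner x y = cnj (cinner y x)" "cinner (x + y) z = cinner x z + cinner y z"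
    "cinner (a *\<^sub>C x) y = a * cinner x y" "cinner x x = 0 \<longleftrightarrow> x = 0"
    by (simp_all add: scaleC_complex_def cinner_complex_def algebra_simps)
  show "0 \<le> Re (cinner x x)"
    by (simp add: cinner_complex_def)
  show "norm x = sqrt (Re (cinner x x))"
    by (simp add: cinner_complex_def cmod_def power2_eq_square)
  show "r *\<^sub>R x = complex_of_real r *\<^sub>C x"
    by (simp add: scaleC_complex_def scaleR_conv_of_real)
qed

end

text \<open>
  A finite-dimensional Hilbert space is represented as a finite-dimensional subspace
  of an arbitrary complex inner product space, so that a subspace of a coefficient
  space can itself serve as a coefficient space.
\<close>

definition fin_dim_subspace :: "'a::complex_vector set \<Rightarrow> bool" where
  "fin_dim_subspace E \<longleftrightarrow> (\<exists>B. finite B \<and> E = complex_vector.span B)"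

text \<open>Operators between subspaces are functions whose values off the domain are irrelevant.\<close>

definition bounded_op ::
  "'a::complex_inner set \<Rightarrow> 'b::complex_inner set \<Rightarrow> ('a \<Rightarrow> 'b) \<Rightarrow> bool" where
  "bounded_op X Y T \<longleftrightarrow>
     T ` X \<subseteq> Y \<and>
     (\<forall>x\<in>X. \<forall>y\<in>X. T (x + y) = T x + T y) \<and>
     (\<forall>c. \<forall>x\<in>X. T (c *\<^sub>C x) = c *\<^sub>C T x) \<and>
     (\<exists>K. \<forall>x\<in>X. cnorm (T x) \<le> K * cnorm x)"

definition selfadjoint_on :: "'a::complex_inner set \<Rightarrow> ('a \<Rightarrow> 'a) \<Rightarrow> bool" where
  "selfadjoint_on E T \<longleftrightarrow> bounded_op E E T \<and> (\<forall>x\<in>E. \<forall>y\<in>E. cinner (T x) y = cinner x (T y))"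

text \<open>
  The adjoint of an operator defined on the whole of its domain type; for a bounded
  operator with values in a subspace \<open>E\<close> of the codomain type, its restriction
  to \<open>E\<close> is the adjoint of the operator into \<open>E\<close>.
\<close>

definition cadjoint :: "('a::complex_inner \<Rightarrow> 'b::complex_inner) \<Rightarrow> 'b \<Rightarrow> 'a" where
  "cadjoint T y = (THE z. \<forall>x. cinner (T x) y = cinner x z)"

definition invertible_op :: "('a::complex_inner \<Rightarrow> 'a) \<Rightarrow> bool" where
  "invertible_op T \<longleftrightarrow> bij T \<and> bounded_op UNIV UNIV (inv T)"

definition orth_proj :: "'a::complex_inner set \<Rightarrow> 'a \<Rightarrow> 'a" where
  "orth_proj S w = (THE v. v \<in> S \<and> (\<forall>u\<in>S. cinner (w - v) u = 0))"

definition orthonormal_basis_of :: "'a::complex_inner set \<Rightarrow> ('m::finite \<Rightarrow> 'a) \<Rightarrow> bool" where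
  "orthonormal_basis_of E e \<longleftrightarrow>
     (\<forall>i j. cinner (e i) (e j) = (if i = j then 1 else 0)) \<and>
     complex_vector.span (range e) = E"

section \<open>Two-operator commutative vessels\<close>

locale commutative_vessel =
  fixes A1 A2 :: "'h::complex_hilbert \<Rightarrow> 'h"
    and \<Phi> :: "'h \<Rightarrow> 'e::complex_inner"
    and E :: "'e set"
    and \<sigma>1 \<sigma>2 \<gamma>in \<gamma>out :: "'e \<Rightarrow> 'e"
  assumes bounded_A1: "bounded_op UNIV UNIV A1"
    and bounded_A2: "bounded_op UNIV UNIV A2"
    and commute: "A1 \<circ> A2 = A2 \<circ> A1"
    and fin_dim_E: "fin_dim_subspace E"
    and bounded_Phi: "bounded_op UNIV E \<Phi>"
    and selfadjoint_sigma1: "selfadjoint_on E \<sigma>1"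
    and selfadjoint_sigma2: "selfadjoint_on E \<sigma>2"
    and selfadjoint_gamma_in: "selfadjoint_on E \<gamma>in"
    and selfadjoint_gamma_out: "selfadjoint_on E \<gamma>out"
    and colligation1: "cadjoint \<Phi> (\<sigma>1 (\<Phi> h)) = (1 / \<i>) *\<^sub>C (A1 h - cadjoint A1 h)"
    and colligation2: "cadjoint \<Phi> (\<sigma>2 (\<Phi> h)) = (1 / \<i>) *\<^sub>C (A2 h - cadjoint A2 h)"
    and input_condition: "\<gamma>in (\<Phi> h) = \<sigma>1 (\<Phi> (cadjoint A2 h)) - \<sigma>2 (\<Phi> (cadjoint A1 h))"
    and output_condition: "\<gamma>out (\<Phi> h) = \<sigma>1 (\<Phi> (A2 h)) - \<sigma>2 (\<Phi> (A1 h))"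
    and linkage_condition: "v \<in> E \<Longrightarrow> \<gamma>out v = \<gamma>in v +
      \<i> *\<^sub>C (\<sigma>1 (\<Phi> (cadjoint \<Phi> (\<sigma>2 v))) - \<sigma>2 (\<Phi> (cadjoint \<Phi> (\<sigma>1 v))))"

section \<open>Polynomials in two and three variables\<close>

text \<open>
  A polynomial is a finitely supported function from exponent vectors to coefficients;
  multiplication of \<^typ>\<open>(nat \<times> nat) \<Rightarrow>\<^sub>0 'a::comm_semiring_1\<close> is convolution.
\<close>

type_synonym 'a poly2 = "(nat \<times> nat) \<Rightarrow>\<^sub>0 'a"
type_synonym 'a poly3 = "(nat \<times> nat \<times> nat) \<Rightarrow>\<^sub>0 'a"

definition op_entry :: "('m \<Rightarrow> 'a::complex_inner) \<Rightarrow> ('a \<Rightarrow> 'a) \<Rightarrow> 'm \<Rightarrow> 'm \<Rightarrow> complex" where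
  "op_entry e T i j = cinner (T (e j)) (e i)"

definition discriminant ::
  "('m::finite \<Rightarrow> 'a::complex_inner) \<Rightarrow> ('a \<Rightarrow> 'a) \<Rightarrow> ('a \<Rightarrow> 'a) \<Rightarrow> ('a \<Rightarrow> 'a) \<Rightarrow> complex poly2" where
  "discriminant e \<sigma>1 \<sigma>2 \<gamma> = det ((\<chi> i j.
     Poly_Mapping.single (1, 0) (op_entry e \<sigma>2 i j)
     - Poly_Mapping.single (0, 1) (op_entry e \<sigma>1 i j)
     + Poly_Mapping.single (0, 0) (op_entry e \<gamma> i j)) :: (complex poly2)^'m^'m)"

definition hom_discriminant ::
  "('m::finite \<Rightarrow> 'a::complex_inner) \<Rightarrow> ('a \<Rightarrow> 'a) \<Rightarrow> ('a \<Rightarrow> 'a) \<Rightarrow> ('a \<Rightarrow> 'a) \<Rightarrow> complex poly3" where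
  "hom_discriminant e \<sigma>1 \<sigma>2 \<gamma> = det ((\<chi> i j.
     Poly_Mapping.single (1, 0, 0) (op_entry e \<gamma> i j)
     + Poly_Mapping.single (0, 1, 0) (op_entry e \<sigma>2 i j)
     - Poly_Mapping.single (0, 0, 1) (op_entry e \<sigma>1 i j)) :: (complex poly3)^'m^'m)"

text \<open>Total degree, with the convention that the zero polynomial has degree 0.\<close>

definition total_degree :: "'a::zero poly2 \<Rightarrow> nat" where
  "total_degree p = Max (insert 0 ((\<lambda>(a, b). a + b) ` Poly_Mapping.keys p))"

text \<open>Homogenization to degree \<open>n\<close>, for a real polynomial of total degree at most \<open>n\<close>.\<close>

definition homogenize :: "nat \<Rightarrow> real poly2 \<Rightarrow> complex poly3" where
  "homogenize n p = (\<Sum>(a, b)\<in>Poly_Mapping.keys p.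
     Poly_Mapping.single (n - (a + b), a, b) (complex_of_real (Poly_Mapping.lookup p (a, b))))"

definition eval3 :: "complex poly3 \<Rightarrow> complex \<Rightarrow> complex \<Rightarrow> complex \<Rightarrow> complex" where
  "eval3 P x0 x1 x2 = (\<Sum>(a, b, c)\<in>Poly_Mapping.keys P.
     Poly_Mapping.lookup P (a, b, c) * x0 ^ a * x1 ^ b * x2 ^ c)"

definition op_poly ::
  "real poly2 \<Rightarrow> ('h::complex_vector \<Rightarrow> 'h) \<Rightarrow> ('h \<Rightarrow> 'h) \<Rightarrow> 'h \<Rightarrow> 'h" where
  "op_poly p A1 A2 h = (\<Sum>(a, b)\<in>Poly_Mapping.keys p.
     complex_of_real (Poly_Mapping.lookup p (a, b)) *\<^sub>C ((A1 ^^ a) ((A2 ^^ b) h)))"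

definition op_rat ::
  "real poly2 \<Rightarrow> real poly2 \<Rightarrow> ('h::complex_vector \<Rightarrow> 'h) \<Rightarrow> ('h \<Rightarrow> 'h) \<Rightarrow> 'h \<Rightarrow> 'h" where
  "op_rat p q A1 A2 = inv (op_poly q A1 A2) \<circ> op_poly p A1 A2"

section \<open>The spaces of multi-indexed vectors and the principal subspace\<close>

text \<open>
  \<open>W\<^sub>n\<close> lives inside the finitely supported \<open>'e\<close>-valued
  functions on pairs, with the sum of the componentwise inner products.
\<close>

instantiation poly_mapping :: (type, complex_inner) complex_inner
begin

definition scaleC_poly_mapping :: "complex \<Rightarrow> ('a \<Rightarrow>\<^sub>0 'b) \<Rightarrow> ('a \<Rightarrow>\<^sub>0 'b)" where
  "scaleC_poly_mapping c w = Poly_Mapping.map (\<lambda>v. c *\<^sub>C v) w"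

definition cinner_poly_mapping :: "('a \<Rightarrow>\<^sub>0 'b) \<Rightarrow> ('a \<Rightarrow>\<^sub>0 'b) \<Rightarrow> complex" where
  "cinner_poly_mapping v w =
     (\<Sum>i\<in>Poly_Mapping.keys v. cinner (Poly_Mapping.lookup v i) (Poly_Mapping.lookup w i))"

instance
proof
  have z: "c *\<^sub>C (0::'b) = 0" for c
    by simp
  have l: "Poly_Mapping.lookup (c *\<^sub>C w) i = c *\<^sub>C Poly_Mapping.lookup w i"
    for c and w :: "'a \<Rightarrow>\<^sub>0 'b" and i
    by (simp add: scaleC_poly_mapping_def Poly_Mapping.map.rep_eq when_def z)
  have c0l: "cinner (0::'b) y = 0" for y
    using cinner_scaleC_left[of 0 "0::'b" y] by simp
  have c0r: "cinner y (0::'b) = 0" for y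
    using cinner_commute[of y "0::'b"] c0l[of y] by simp
  have ext: "cinner v w = (\<Sum>i\<in>S. cinner (Poly_Mapping.lookup v i) (Poly_Mapping.lookup w i))"
    if "finite S" "Poly_Mapping.keys v \<subseteq> S" for v w :: "'a \<Rightarrow>\<^sub>0 'b" and S
    unfolding cinner_poly_mapping_def using that
    by (intro sum.mono_neutral_left) (auto simp: in_keys_iff c0l)
  fix a b :: complex and x y w :: "'a \<Rightarrow>\<^sub>0 'b"
  show "a *\<^sub>C (x + y) = a *\<^sub>C x + a *\<^sub>C y" "(a + b) *\<^sub>C x = a *\<^sub>C x + b *\<^sub>C x"
    "a *\<^sub>C b *\<^sub>C x = (a * b) *\<^sub>C x" "1 *\<^sub>C x = x"
    by (rule poly_mapping_eqI, simp add: l lookup_add scaleC_add_right scaleC_add_left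
        scaleC_scaleC scaleC_one)+
  let ?S = "Poly_Mapping.keys x \<union> Poly_Mapping.keys y"
  have fin: "finite ?S" by simp
  show "cinner x y = cnj (cinner y x)"
    unfolding ext[OF fin Un_upper1, of y] ext[OF fin Un_upper2, of x] cnj_sum
    by (intro sum.cong refl) (rule cinner_commute)
  have "Poly_Mapping.keys (x + y) \<subseteq> ?S" by (rule Poly_Mapping.keys_add)
  then show "cinner (x + y) w = cinner x w + cinner y w"
    unfolding ext[OF fin Un_upper1, of w] ext[OF fin Un_upper2, of w]
    by (simp add: ext[OF fin] lookup_add cinner_add_left sum.distrib)
  have "Poly_Mapping.keys (a *\<^sub>C x) \<subseteq> Poly_Mapping.keys x"
    by (auto simp: in_keys_iff l)
  then show "cinner (a *\<^sub>C x) y = a * cinner x y"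
    by (simp add: ext[of "Poly_Mapping.keys x"] l cinner_scaleC_left sum_distrib_left)
  show "0 \<le> Re (cinner x x)"
    by (simp add: cinner_poly_mapping_def sum_nonneg cinner_ge_zero)
  show "cinner x x = 0 \<longleftrightarrow> x = 0"
  proof
    assume "cinner x x = 0"
    then have "(\<Sum>i\<in>Poly_Mapping.keys x.
        Re (cinner (Poly_Mapping.lookup x i) (Poly_Mapping.lookup x i))) = 0"
      by (simp add: cinner_poly_mapping_def flip: Re_sum)
    then have *: "\<forall>i\<in>Poly_Mapping.keys x.
        Re (cinner (Poly_Mapping.lookup x i) (Poly_Mapping.lookup x i)) = 0"
      by (subst (asm) sum_nonneg_eq_0_iff) (auto simp: cinner_ge_zero)
    have im: "Im (cinner v v) = 0" for v :: 'b
      using arg_cong[OF cinner_commute[of v v], of Im] by simp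
    have "Poly_Mapping.lookup x i = 0" for i
      using * im cinner_eq_zero_iff[of "Poly_Mapping.lookup x i"]
      by (metis complex_eqI in_keys_iff zero_complex.simps)
    then show "x = 0" by (intro poly_mapping_eqI) simp
  qed (simp add: cinner_poly_mapping_def)
qed

end

text \<open>
  The pair \<open>(i\<^sub>1, i\<^sub>2)\<close> stands for the multi-index
  \<open>(n - 1 - i\<^sub>1 - i\<^sub>2, i\<^sub>1, i\<^sub>2)\<close> of length \<open>n - 1\<close>;
  for \<open>n = 0\<close> there are none.
\<close>

definition multi_indices :: "nat \<Rightarrow> (nat \<times> nat) set" where
  "multi_indices n = {(i1, i2). i1 + i2 < n}"

definition multi_power :: "nat \<Rightarrow> nat \<times> nat \<Rightarrow> complex \<Rightarrow> complex \<Rightarrow> complex \<Rightarrow> complex" where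
  "multi_power n i x0 x1 x2 = x0 ^ (n - 1 - fst i - snd i) * x1 ^ fst i * x2 ^ snd i"

type_synonym 'e mvec = "(nat \<times> nat) \<Rightarrow>\<^sub>0 'e"

definition W_space :: "nat \<Rightarrow> 'e::complex_inner set \<Rightarrow> 'e mvec set" where
  "W_space n E = {w. Poly_Mapping.keys w \<subseteq> multi_indices n \<and>
     (\<forall>i\<in>multi_indices n. Poly_Mapping.lookup w i \<in> E)}"

definition principal_subspace ::
  "nat \<Rightarrow> 'e::complex_inner set \<Rightarrow> ('e \<Rightarrow> 'e) \<Rightarrow> ('e \<Rightarrow> 'e) \<Rightarrow> ('e \<Rightarrow> 'e) \<Rightarrow> 'e mvec set" where
  "principal_subspace n E \<sigma>1 \<sigma>2 \<gamma>in = {w \<in> W_space n E. \<forall>i1 i2. i1 + i2 + 2 \<le> n \<longrightarrow>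
     \<sigma>2 (Poly_Mapping.lookup w (i1 + 1, i2)) - \<sigma>1 (Poly_Mapping.lookup w (i1, i2 + 1))
     + \<gamma>in (Poly_Mapping.lookup w (i1, i2)) = 0}"

section \<open>Generalized Bezout matrices\<close>

text \<open>A matrix with rows and columns indexed by \<^const>\<open>multi_indices\<close>.\<close>

type_synonym mi_matrix = "nat \<times> nat \<Rightarrow> nat \<times> nat \<Rightarrow> complex"

text \<open>
  Triples of generalized Bezout matrices, in the order
  \<open>(\<beta>\<^sup>1\<^sup>0, \<beta>\<^sup>2\<^sup>0, \<beta>\<^sup>1\<^sup>2)\<close>.
  Such a triple is not unique. Since \<open>\<complex>\<close> is infinite, the defining polynomial identity
  is stated as an identity of values.
\<close>

type_synonym bezout_triple = "mi_matrix \<times> mi_matrix \<times> mi_matrix"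

definition sym_mi_matrix :: "nat \<Rightarrow> mi_matrix \<Rightarrow> bool" where
  "sym_mi_matrix n b \<longleftrightarrow> (\<forall>i\<in>multi_indices n. \<forall>j\<in>multi_indices n. b i j = b j i)"

fun is_bezout :: "nat \<Rightarrow> complex poly3 \<Rightarrow> complex poly3 \<Rightarrow> bezout_triple \<Rightarrow> bool" where
  "is_bezout n p q (b10, b20, b12) \<longleftrightarrow>
     sym_mi_matrix n b10 \<and> sym_mi_matrix n b20 \<and> sym_mi_matrix n b12 \<and>
     (\<forall>x0 x1 x2 y0 y1 y2.
        eval3 p x0 x1 x2 * eval3 q y0 y1 y2 - eval3 q x0 x1 x2 * eval3 p y0 y1 y2 =
        (\<Sum>i\<in>multi_indices n. \<Sum>j\<in>multi_indices n.
           b10 i j * multi_power n i x0 x1 x2 * (x1 * y0 - x0 * y1) * multi_power n j y0 y1 y2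
         + b20 i j * multi_power n i x0 x1 x2 * (x2 * y0 - x0 * y2) * multi_power n j y0 y1 y2
         + b12 i j * multi_power n i x0 x1 x2 * (x1 * y2 - x2 * y1) * multi_power n j y0 y1 y2))"

text \<open>\<open>\<beta>\<^sup>1\<^sup>2 \<otimes> \<gamma>in + \<beta>\<^sup>1\<^sup>0 \<otimes> \<sigma>1 + \<beta>\<^sup>2\<^sup>0 \<otimes> \<sigma>2\<close>\<close>

fun bezout_op ::
  "nat \<Rightarrow> ('e::complex_inner \<Rightarrow> 'e) \<Rightarrow> ('e \<Rightarrow> 'e) \<Rightarrow> ('e \<Rightarrow> 'e) \<Rightarrow> bezout_triple \<Rightarrow> 'e mvec \<Rightarrow> 'e mvec" where
  "bezout_op n \<sigma>1 \<sigma>2 \<gamma>in (b10, b20, b12) w =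
     (\<Sum>i\<in>multi_indices n. Poly_Mapping.single i (\<Sum>j\<in>multi_indices n.
        b12 i j *\<^sub>C \<gamma>in (Poly_Mapping.lookup w j)
        + b10 i j *\<^sub>C \<sigma>1 (Poly_Mapping.lookup w j)
        + b20 i j *\<^sub>C \<sigma>2 (Poly_Mapping.lookup w j)))"

definition compressed_bezout_op ::
  "nat \<Rightarrow> 'e::complex_inner set \<Rightarrow> ('e \<Rightarrow> 'e) \<Rightarrow> ('e \<Rightarrow> 'e) \<Rightarrow> ('e \<Rightarrow> 'e) \<Rightarrow> bezout_triple \<Rightarrow>
   'e mvec \<Rightarrow> 'e mvec" where
  "compressed_bezout_op n E \<sigma>1 \<sigma>2 \<gamma>in b w =
     (let V = principal_subspace n E \<sigma>1 \<sigma>2 \<gamma>in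
      in orth_proj V (bezout_op n \<sigma>1 \<sigma>2 \<gamma>in b (orth_proj V w)))"

section \<open>The transformed data\<close>

definition transformed_Phi ::
  "nat \<Rightarrow> real poly2 \<Rightarrow> ('h::complex_inner \<Rightarrow> 'h) \<Rightarrow> ('h \<Rightarrow> 'h) \<Rightarrow> ('h \<Rightarrow> 'e::complex_inner) \<Rightarrow> 'e set \<Rightarrow>
   ('e \<Rightarrow> 'e) \<Rightarrow> ('e \<Rightarrow> 'e) \<Rightarrow> ('e \<Rightarrow> 'e) \<Rightarrow> 'h \<Rightarrow> 'e mvec" where
  "transformed_Phi n p0 A1 A2 \<Phi> E \<sigma>1 \<sigma>2 \<gamma>in h =
     orth_proj (principal_subspace n E \<sigma>1 \<sigma>2 \<gamma>in)
       (\<Sum>(i1, i2)\<in>multi_indices n. Poly_Mapping.single (i1, i2)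
          (\<Phi> ((cadjoint A1 ^^ i1) ((cadjoint A2 ^^ i2)
             (inv (op_poly p0 (cadjoint A1) (cadjoint A2)) h)))))"

definition transformed_gamma_out ::
  "('h::complex_inner \<Rightarrow> 'e::complex_inner) \<Rightarrow> ('e \<Rightarrow> 'e) \<Rightarrow> ('e \<Rightarrow> 'e) \<Rightarrow> ('e \<Rightarrow> 'e) \<Rightarrow> 'e \<Rightarrow> 'e" where
  "transformed_gamma_out \<Phi> \<sigma>1 \<sigma>2 \<gamma>in v = \<gamma>in v +
     \<i> *\<^sub>C (\<sigma>1 (\<Phi> (cadjoint \<Phi> (\<sigma>2 v))) - \<sigma>2 (\<Phi> (cadjoint \<Phi> (\<sigma>1 v))))"

end

theory Submission
  imports Defs
begin

text \<open>
  Write \<open>B\<^sub>k\<close> for the adjoint of \<open>A\<^sub>k\<close>. For a vector \<open>k\<close> let \<open>W k\<close> be the family of all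
  \<open>\<Phi> B\<^sub>1\<^sup>a B\<^sub>2\<^sup>b k\<close> with \<open>a + b < n\<close> (\<open>moment_vec\<close>). The input condition of the given vessel says
  exactly that \<open>W k\<close> lies in the principal subspace, so the projection in the definition of the new
  \<open>\<Phi>'\<close> does nothing and \<open>\<Phi>' h = W (p\<^sub>0(B)\<^sup>-\<^sup>1 h)\<close>.

  \<^item> Colligation conditions. Sandwiched between \<open>\<Phi>\<close> and its adjoint, \<open>\<sigma>\<^sub>1\<close>, \<open>\<sigma>\<^sub>2\<close>, \<open>\<gamma>in\<close> become
    \<open>1/\<i>\<close> times \<open>A\<^sub>1 - B\<^sub>1\<close>, \<open>A\<^sub>2 - B\<^sub>2\<close>, \<open>A\<^sub>1 B\<^sub>2 - A\<^sub>2 B\<^sub>1\<close>. These are the three \<open>2 \<times> 2\<close> minors that occur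
    in the Bezout identity, with \<open>A\<close> substituted for \<open>x\<close> on the left and \<open>B\<close> for \<open>y\<close> on the right,
    so the identity itself evaluates the quadratic form of the Bezout operator on the vectors \<open>W k\<close>
    to \<open>1/\<i>\<close> times \<open>p(A) q(B) - q(A) p(B)\<close> (\<open>cinner_bezout_op_moment_vecs\<close>).

  \<^item> Input condition and selfadjointness. Both are the vanishing of a pairing of the form
    \<open>\<langle>(\<beta>\<^sup>1\<^sup>2 \<otimes> \<gamma>in + \<beta>\<^sup>1\<^sup>0 \<otimes> \<sigma>\<^sub>1 + \<beta>\<^sup>2\<^sup>0 \<otimes> \<sigma>\<^sub>2) w, v\<rangle>\<close> in which the polynomials belonging to
    \<open>(\<beta>\<^sup>1\<^sup>2, \<beta>\<^sup>2\<^sup>0, -\<beta>\<^sup>1\<^sup>0)\<close> form a syzygy of the minors of the points \<open>x\<close> and \<open>y\<close>. Every such syzygy is a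
    combination \<open>x d + y c\<close> of the two obvious ones (\<open>minors_syzygy\<close>, an instance of the Hilbert-Burch
    theorem). The part \<open>x d\<close> is killed because \<open>v\<close> is in the principal subspace, the part \<open>y c\<close>
    because \<open>w\<close> satisfies the same relations (\<open>pairing_vanishes\<close>); for this the degrees of \<open>c\<close> and
    \<open>d\<close> have to be controlled. For the input condition the syzygy is
    \<open>p\<^sub>0(y) \<beta>(p\<^sub>1, p\<^sub>2) - p\<^sub>2(y) \<beta>(p\<^sub>1, p\<^sub>0) + p\<^sub>1(y) \<beta>(p\<^sub>2, p\<^sub>0)\<close>. For selfadjointness it is the difference of
    a Bezout triple and its complex conjugate: the matrices need not be real, but two triples for the
    same pair of polynomials have the same compression to the principal subspace.

  \<^item> Output condition. With the output operator defined by the linkage condition, it follows from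
    the colligation and the input conditions (\<open>commutative_vessel_transformed_gamma_out\<close>).
\<close>

section \<open>Geometry of complex inner product spaces\<close>

lemma cinner_add_right: "cinner x (y + z) = cinner x y + cinner (x::'a::complex_inner) z"
  by (simp add: cinner_commute[of x] cinner_add_left)

lemma cinner_scaleC_right: "cinner x (a *\<^sub>C y) = cnj a * cinner (x::'a::complex_inner) y"
  by (simp add: cinner_commute[of x] cinner_scaleC_left)

lemma cinner_zero_left [simp]: "cinner 0 (y::'a::complex_inner) = 0"
  using cinner_add_left[of 0 0 y] by simp

lemma cinner_zero_right [simp]: "cinner (y::'a::complex_inner) 0 = 0"
  using cinner_add_right[of y 0 0] by simp

lemma cinner_minus_left [simp]: "cinner (- x) (y::'a::complex_inner) = - cinner x y"
  using cinner_add_left[of x "- x" y] by (simp add: eq_neg_iff_add_eq_0 add.commute)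

lemma cinner_minus_right [simp]: "cinner x (- y::'a::complex_inner) = - cinner x y"
  using cinner_add_right[of x y "- y"] by (simp add: eq_neg_iff_add_eq_0 add.commute)

lemma cinner_diff_left: "cinner (x - y) (z::'a::complex_inner) = cinner x z - cinner y z"
  using cinner_add_left[of x "- y" z] by simp

lemma cinner_diff_right: "cinner x (y - z::'a::complex_inner) = cinner x y - cinner x z"
  using cinner_add_right[of x y "- z"] by simp

lemmas cinner_simps = cinner_add_left cinner_add_right cinner_diff_left cinner_diff_right
  cinner_scaleC_left cinner_scaleC_right

lemma cinner_sum_left: "cinner (sum f A) (z::'a::complex_inner) = (\<Sum>i\<in>A. cinner (f i) z)"
  by (induction A rule: infinite_finite_induct) (simp_all add: cinner_add_left)

lemma cinner_sum_right: "cinner z (sum f A :: 'a::complex_inner) = (\<Sum>i\<in>A. cinner z (f i))"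
  by (induction A rule: infinite_finite_induct) (simp_all add: cinner_add_right)

lemma cinner_self_of_real: "cinner x (x::'a::complex_inner) = complex_of_real ((cnorm x)\<^sup>2)"
proof -
  have "Im (cinner x x) = 0"
    using arg_cong[OF cinner_commute[of x x], of Im] by simp
  then show ?thesis
    by (simp add: cnorm_def cinner_ge_zero complex_eq_iff)
qed

lemma cnorm_square: "(cnorm x)\<^sup>2 = Re (cinner x x)"
  by (simp add: cnorm_def cinner_ge_zero)

lemma cnorm_nonneg [simp]: "0 \<le> cnorm x"
  by (simp add: cnorm_def cinner_ge_zero)

lemma cnorm_eq_0_iff [simp]: "cnorm x = 0 \<longleftrightarrow> x = 0"
  using cinner_self_of_real[of x] cinner_eq_zero_iff[of x] by auto

lemma cnorm_zero [simp]: "cnorm 0 = 0"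
  by simp

lemma cinner_extensional:
  assumes "\<And>x. cinner x y = cinner x (z::'a::complex_inner)"
  shows "y = z"
proof -
  have "cinner (y - z) (y - z) = 0"
    using assms[of "y - z"] by (simp add: cinner_diff_right)
  then show ?thesis
    by (simp add: cinner_eq_zero_iff)
qed

text \<open>
  Subtracting from \<open>x\<close> its component along \<open>y\<close> shortens \<open>x\<close> by a known amount. That the result is
  nonnegative is the Cauchy-Schwarz inequality; that a vector of minimal norm cannot be shortened
  is the orthogonality in the Riesz theorem.
\<close>

lemma cnorm_remove_component:
  assumes "y \<noteq> (0::'a::complex_inner)"
  shows "(cnorm (x - (cinner x y / cinner y y) *\<^sub>C y))\<^sup>2
    = (cnorm x)\<^sup>2 - (cmod (cinner x y))\<^sup>2 / (cnorm y)\<^sup>2"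
proof -
  have N: "cinner y y \<noteq> 0" and yx: "cinner y x = cnj (cinner x y)"
    using assms by (simp_all add: cinner_eq_zero_iff cinner_commute[of y x])
  have "cinner (x - (cinner x y / cinner y y) *\<^sub>C y) (x - (cinner x y / cinner y y) *\<^sub>C y)
      = cinner x x - cinner x y * cnj (cinner x y) / cinner y y"
    using N cinner_commute[of y y, symmetric] by (simp add: cinner_simps yx divide_simps)
  then have "complex_of_real ((cnorm (x - (cinner x y / cinner y y) *\<^sub>C y))\<^sup>2)
      = complex_of_real ((cnorm x)\<^sup>2 - (cmod (cinner x y))\<^sup>2 / (cnorm y)\<^sup>2)"
    by (simp only: cinner_self_of_real[symmetric] of_real_diff of_real_divide complex_norm_square)
  then show ?thesis
    using of_real_eq_iff by blast
qed

lemma Cauchy_Schwarz_cinner: "cmod (cinner x y) \<le> cnorm x * cnorm (y::'a::complex_inner)"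
proof (cases "y = 0")
  case False
  have "0 \<le> (cnorm x)\<^sup>2 - (cmod (cinner x y))\<^sup>2 / (cnorm y)\<^sup>2"
    by (metis cnorm_remove_component[OF False] zero_le_power2)
  then have "(cmod (cinner x y))\<^sup>2 \<le> (cnorm x * cnorm y)\<^sup>2"
    using False by (simp add: divide_simps power_mult_distrib split: if_splits)
  then show ?thesis
    by (rule power2_le_imp_le) simp
qed simp

lemma cnorm_triangle: "cnorm (x + y) \<le> cnorm x + cnorm (y::'a::complex_inner)"
proof (rule power2_le_imp_le)
  have "(cnorm (x + y))\<^sup>2 = (cnorm x)\<^sup>2 + (cnorm y)\<^sup>2 + Re (cinner x y) + Re (cinner y x)"
    by (simp add: cnorm_square cinner_simps)
  also have "\<dots> \<le> (cnorm x)\<^sup>2 + (cnorm y)\<^sup>2 + cnorm x * cnorm y + cnorm y * cnorm x"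
    by (intro add_mono order_refl order_trans[OF complex_Re_le_cmod Cauchy_Schwarz_cinner])
  finally show "(cnorm (x + y))\<^sup>2 \<le> (cnorm x + cnorm y)\<^sup>2"
    by (simp add: power2_sum algebra_simps)
qed simp

lemma cnorm_scaleC: "cnorm (a *\<^sub>C x) = cmod a * cnorm (x::'a::complex_inner)"
proof -
  have "cinner (a *\<^sub>C x) (a *\<^sub>C x) = complex_of_real ((cmod a)\<^sup>2) * cinner x x"
    unfolding complex_norm_square by (simp add: cinner_simps)
  then have "(cnorm (a *\<^sub>C x))\<^sup>2 = (cmod a * cnorm x)\<^sup>2"
    by (simp add: cnorm_square power_mult_distrib del: of_real_power)
  then show ?thesis
    by (rule power2_eq_imp_eq) simp_all
qed

lemma norm_eq_cnorm: "norm x = cnorm (x::'a::complex_hilbert)"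
  by (simp add: norm_eq_sqrt_cinner cnorm_def)

lemma parallelogram_cnorm:
  "(cnorm (x - y))\<^sup>2 + (cnorm (x + y))\<^sup>2 = 2 * (cnorm x)\<^sup>2 + 2 * (cnorm (y::'a::complex_inner))\<^sup>2"
  unfolding cnorm_square by (simp add: cinner_simps)

section \<open>Adjoints\<close>

text \<open>
  A minimizing sequence is Cauchy by the parallelogram law, since midpoints of its members stay in
  the hyperplane.
\<close>

lemma minimal_norm_on_affine_hyperplane:
  fixes f :: "'h::complex_hilbert \<Rightarrow> complex"
  assumes f: "bounded_linear f" and ne: "f a = 1"
  obtains x where "f x = 1" "\<And>y. f y = 1 \<Longrightarrow> norm x \<le> norm y"
proof -
  define \<delta> where "\<delta> = Inf {(norm x)\<^sup>2 |x. f x = 1}"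
  have bdd: "bdd_below {(norm x)\<^sup>2 |x. f x = 1}"
    by (intro bdd_belowI[of _ 0]) auto
  have \<delta>_le: "\<delta> \<le> (norm x)\<^sup>2" if "f x = 1" for x
    unfolding \<delta>_def using that by (intro cInf_lower bdd) auto
  have "\<exists>x. f x = 1 \<and> (norm x)\<^sup>2 < \<delta> + 1 / Suc k" for k
  proof -
    have "Inf {(norm x)\<^sup>2 |x. f x = 1} < \<delta> + 1 / Suc k"
      by (simp add: \<delta>_def)
    then show ?thesis
      using cInf_lessD[of "{(norm x)\<^sup>2 |x. f x = 1}"] ne by blast
  qed
  then have "\<forall>k. \<exists>x. f x = 1 \<and> (norm x)\<^sup>2 < \<delta> + 1 / Suc k"
    by blast
  from choice[OF this] obtain u where
    u: "\<And>k. f (u k) = 1" "\<And>k. (norm (u k))\<^sup>2 < \<delta> + 1 / Suc k"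
    by blast
  interpret f: bounded_linear f by (rule f)
  have close: "(norm (u k - u l))\<^sup>2 \<le> 2 / Suc k + 2 / Suc l" for k l
  proof -
    have "f ((1/2) *\<^sub>R (u k + u l)) = 1"
      by (simp add: f.scaleR f.add u scaleR_conv_of_real)
    then have "\<delta> \<le> (norm (u k + u l) / 2)\<^sup>2"
      using \<delta>_le[of "(1/2) *\<^sub>R (u k + u l)"] by simp
    then have "4 * \<delta> \<le> (norm (u k + u l))\<^sup>2"
      by (simp add: power_divide)
    moreover have "(norm (u k - u l))\<^sup>2 + (norm (u k + u l))\<^sup>2 = 2 * (norm (u k))\<^sup>2 + 2 * (norm (u l))\<^sup>2"
      unfolding norm_eq_cnorm by (rule parallelogram_cnorm)
    moreover have "2 / real (Suc k) = 2 * (1 / real (Suc k))" "2 / real (Suc l) = 2 * (1 / real (Suc l))"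
      by simp_all
    ultimately show ?thesis
      using u(2)[of k] u(2)[of l] by linarith
  qed
  have "Cauchy u"
  proof (rule metric_CauchyI)
    fix e :: real assume "0 < e"
    then obtain M where M: "4 / e\<^sup>2 < real M"
      using reals_Archimedean2 by blast
    have "dist (u k) (u l) < e" if "M \<le> k" "M \<le> l" for k l
    proof -
      have "2 / real (Suc k) \<le> 2 / Suc M" "2 / real (Suc l) \<le> 2 / Suc M"
        using that by (simp_all add: frac_le)
      moreover have "4 / real (Suc M) < e\<^sup>2"
      proof -
        have "4 / e\<^sup>2 < real (Suc M)"
          using M by simp
        then show ?thesis
          using \<open>0 < e\<close> by (simp add: divide_less_eq mult.commute)
      qed
      ultimately have "(norm (u k - u l))\<^sup>2 < e\<^sup>2"
        using close[of k l] by simp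
      then show ?thesis
        using \<open>0 < e\<close> by (simp add: dist_norm power_less_imp_less_base)
    qed
    then show "\<exists>M. \<forall>k\<ge>M. \<forall>l\<ge>M. dist (u k) (u l) < e" by blast
  qed
  then obtain x where x: "u \<longlonglongrightarrow> x"
    using Cauchy_convergent convergent_def by blast
  have "f x = 1"
    using LIMSEQ_unique[OF f.tendsto[OF x]] by (simp add: u)
  moreover have "norm x \<le> norm y" if "f y = 1" for y
  proof -
    have "(\<lambda>k. (norm (u k))\<^sup>2) \<longlonglongrightarrow> (norm x)\<^sup>2"
      by (intro tendsto_power tendsto_norm x)
    moreover have "(\<lambda>k. \<delta> + 1 / Suc k) \<longlonglongrightarrow> \<delta> + 0"
      by (intro tendsto_intros LIMSEQ_Suc[OF lim_1_over_n])
    ultimately have "(norm x)\<^sup>2 \<le> \<delta> + 0"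
      by (rule LIMSEQ_le) (intro exI allI impI less_imp_le u(2))
    with \<delta>_le[OF that] have "(norm x)\<^sup>2 \<le> (norm y)\<^sup>2"
      by linarith
    then show ?thesis
      by (rule power2_le_imp_le) simp
  qed
  ultimately show thesis
    by (rule that)
qed

text \<open>
  The shortest vector \<open>x\<close> with \<open>f x = 1\<close> is orthogonal to the kernel of \<open>f\<close>; scaled suitably it
  represents \<open>f\<close>.
\<close>

theorem Riesz_representation:
  fixes f :: "'h::complex_hilbert \<Rightarrow> complex"
  assumes add: "\<And>x y. f (x + y) = f x + f y" and scale: "\<And>c x. f (c *\<^sub>C x) = c * f x"
    and bounded: "\<And>x. cmod (f x) \<le> K * cnorm x"
  shows "\<exists>z. \<forall>x. f x = cinner x z"
proof (cases "\<forall>x. f x = 0")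
  case True
  then show ?thesis by (intro exI[of _ 0]) simp
next
  case False
  then obtain b where "f b \<noteq> 0" by blast
  then have "f ((1 / f b) *\<^sub>C b) = 1"
    by (simp add: scale)
  moreover have "bounded_linear f"
    by (rule bounded_linear_intro[of _ K])
      (use bounded in \<open>simp_all add: add scale scaleR_eq_scaleC[where 'a = 'h] norm_eq_cnorm[where 'a = 'h]
        scaleR_conv_of_real mult.commute\<close>)
  ultimately obtain x where x: "f x = 1" "\<And>y. f y = 1 \<Longrightarrow> norm x \<le> norm y"
    using minimal_norm_on_affine_hyperplane by metis
  have minus: "f (x - y) = f x - f y" for x y
    using add[of "x - y" y] by simp
  have orth: "cinner y x = 0" if "f y = 0" for y
  proof (cases "y = 0")
    case y: False
    have "f (x - (cinner x y / cinner y y) *\<^sub>C y) = 1"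
      by (simp add: minus scale that x)
    then have "(cnorm x)\<^sup>2 \<le> (cnorm x)\<^sup>2 - (cmod (cinner x y))\<^sup>2 / (cnorm y)\<^sup>2"
      unfolding cnorm_remove_component[OF y, symmetric]
      using x(2) by (intro power_mono) (simp_all flip: norm_eq_cnorm)
    then have "cinner x y = 0"
      using y by (simp add: divide_le_0_iff)
    then show ?thesis
      using cinner_commute[of y x] by simp
  qed simp
  have "x \<noteq> 0"
    using x(1) scale[of 0 0] by auto
  have "f y = cinner y ((1 / cinner x x) *\<^sub>C x)" for y
  proof -
    have "cinner (y - f y *\<^sub>C x) x = 0"
      by (rule orth) (simp add: minus scale x)
    then have "cinner y x = f y * cinner x x"
      by (simp add: cinner_simps)
    then show ?thesis
      using \<open>x \<noteq> 0\<close> by (simp add: cinner_simps cinner_self_of_real)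
  qed
  then show ?thesis by blast
qed

lemma bounded_opD:
  assumes "bounded_op X Y T"
  shows "\<And>x. x \<in> X \<Longrightarrow> T x \<in> Y" "\<And>x y. \<lbrakk>x \<in> X; y \<in> X\<rbrakk> \<Longrightarrow> T (x + y) = T x + T y"
    "\<And>c x. x \<in> X \<Longrightarrow> T (c *\<^sub>C x) = c *\<^sub>C T x"
  using assms by (auto simp: bounded_op_def)

lemma bounded_op_bound:
  assumes "bounded_op X Y T"
  shows "\<exists>K\<ge>0. \<forall>x\<in>X. cnorm (T x) \<le> K * cnorm x"
proof -
  obtain K where K: "\<forall>x\<in>X. cnorm (T x) \<le> K * cnorm x"
    using assms unfolding bounded_op_def by blast
  have "cnorm (T x) \<le> max K 0 * cnorm x" if "x \<in> X" for x
    using K that mult_right_mono[of K "max K 0" "cnorm x"] by fastforce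
  then show ?thesis
    by (intro exI[of _ "max K 0"]) simp
qed

lemma cadjoint_apply_eqI:
  assumes "\<And>x. cinner (T x) y = cinner x z"
  shows "cadjoint T y = z"
  unfolding cadjoint_def
proof (rule the_equality)
  show "\<forall>x. cinner (T x) y = cinner x z"
    using assms by blast
  show "z' = z" if "\<forall>x. cinner (T x) y = cinner x z'" for z'
    by (rule cinner_extensional) (simp flip: assms that[rule_format])
qed

text \<open>
  On a Hilbert space the description in \<^const>\<open>cadjoint\<close> denotes the adjoint, by the Riesz theorem.
\<close>

lemma cinner_cadjoint:
  fixes T :: "'h::complex_hilbert \<Rightarrow> 'b::complex_inner"
  assumes "bounded_op UNIV Y T"
  shows "cinner (T x) y = cinner x (cadjoint T y)"
proof -
  note T = bounded_opD[OF assms]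
  obtain K where K: "K \<ge> 0" "\<And>x. cnorm (T x) \<le> K * cnorm x"
    using bounded_op_bound[OF assms] by auto
  have "\<exists>z. \<forall>x. cinner (T x) y = cinner x z"
  proof (rule Riesz_representation)
    show "cinner (T (u + v)) y = cinner (T u) y + cinner (T v) y" for u v
      by (simp add: T cinner_simps)
    show "cinner (T (c *\<^sub>C u)) y = c * cinner (T u) y" for c u
      by (simp add: T cinner_simps)
    show "cmod (cinner (T u) y) \<le> K * cnorm y * cnorm u" for u
      using Cauchy_Schwarz_cinner[of "T u" y] mult_right_mono[OF K(2)[of u] cnorm_nonneg[of y]]
      by (simp add: mult_ac)
  qed
  then obtain z where z: "\<And>x. cinner (T x) y = cinner x z" by blast
  then have "cadjoint T y = z"
    by (rule cadjoint_apply_eqI)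
  with z show ?thesis by simp
qed

lemma cinner_cadjoint_left:
  fixes T :: "'h::complex_hilbert \<Rightarrow> 'b::complex_inner"
  assumes "bounded_op UNIV Y T"
  shows "cinner (cadjoint T y) x = cinner y (T x)"
  by (simp add: cinner_commute[of y] cinner_commute[of _ x] cinner_cadjoint[OF assms])

lemma bounded_op_cadjoint:
  fixes T :: "'h::complex_hilbert \<Rightarrow> 'b::complex_inner"
  assumes T: "bounded_op UNIV Y T"
  shows "bounded_op X UNIV (cadjoint T)"
proof -
  note adj = cinner_cadjoint[OF T, symmetric]
  obtain K where K: "K \<ge> 0" "\<And>x. cnorm (T x) \<le> K * cnorm x"
    using bounded_op_bound[OF T] by auto
  have "cnorm (cadjoint T y) \<le> K * cnorm y" for y
  proof -
    let ?z = "cadjoint T y"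
    have "(cnorm ?z)\<^sup>2 = cmod (cinner (T ?z) y)"
      by (simp add: cinner_cadjoint[OF T] cinner_self_of_real norm_power)
    also have "\<dots> \<le> (K * cnorm ?z) * cnorm y"
      by (rule order_trans[OF Cauchy_Schwarz_cinner mult_right_mono[OF K(2)]]) simp
    finally have "cnorm ?z * cnorm ?z \<le> cnorm ?z * (K * cnorm y)"
      by (simp add: power2_eq_square mult_ac)
    then show ?thesis
      using K(1) by (cases "?z = 0") (simp_all add: mult_le_cancel_left less_le)
  qed
  moreover have "cadjoint T (u + v) = cadjoint T u + cadjoint T v"
    "cadjoint T (c *\<^sub>C u) = c *\<^sub>C cadjoint T u" for u v c
    by (rule cinner_extensional, simp add: cinner_simps adj)+
  ultimately show ?thesis
    unfolding bounded_op_def by blast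
qed

section \<open>Orthogonal projections\<close>

text \<open>
  Gram-Schmidt: a new generator \<open>b\<close> is replaced by its component \<open>d\<close> orthogonal to the span so far,
  and the projections onto the old span and onto \<open>d\<close> are added.
\<close>

lemma orthogonal_decomposition_span:
  assumes "finite B"
  shows "\<exists>v\<in>complex_vector.span B. \<forall>u\<in>complex_vector.span B. cinner (w - v) (u::'a::complex_inner) = 0"
  using assms
proof (induction B arbitrary: w)
  case empty
  then show ?case by simp
next
  case (insert b B)
  let ?S = "complex_vector.span B" and ?T = "complex_vector.span (insert b B)"
  obtain vb where vb: "vb \<in> ?S" "\<And>u. u \<in> ?S \<Longrightarrow> cinner (b - vb) u = 0"
    using insert.IH by blast
  obtain vw where vw: "vw \<in> ?S" "\<And>u. u \<in> ?S \<Longrightarrow> cinner (w - vw) u = 0"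
    using insert.IH by blast
  define d where "d = b - vb"
  define v where "v = vw + (cinner w d / cinner d d) *\<^sub>C d"
  have sub: "?S \<subseteq> ?T"
    by (intro complex_vector.span_mono) auto
  have dT: "d \<in> ?T"
    unfolding d_def using vb(1) sub by (intro complex_vector.span_diff) (auto intro: complex_vector.span_base)
  have vd: "cinner vw d = 0"
    using vb(2)[OF vw(1)] cinner_commute[of vw d] by (simp add: d_def)
  have "cinner (w - v) u = 0" if u: "u \<in> ?T" for u
  proof -
    obtain k where k: "u - k *\<^sub>C b \<in> ?S"
      using u by (auto simp: complex_vector.span_insert)
    have "u - k *\<^sub>C d = (u - k *\<^sub>C b) + k *\<^sub>C vb"
      by (simp add: d_def complex_vector.scale_right_diff_distrib)
    then have s: "u - k *\<^sub>C d \<in> ?S" (is "?s \<in> _")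
      using k vb(1) by (simp only: complex_vector.span_add complex_vector.span_scale)
    have "cinner d ?s = 0"
      using vb(2)[OF s] by (simp add: d_def)
    then have "cinner (w - v) ?s = 0"
      using vw(2)[OF s] by (simp only: v_def diff_diff_eq[symmetric] cinner_diff_left[of "w - vw"]
          cinner_scaleC_left) simp
    moreover have "cinner (w - v) d = 0"
      by (cases "d = 0") (simp_all add: v_def cinner_simps vd cinner_eq_zero_iff)
    ultimately have "cinner (w - v) (?s + k *\<^sub>C d) = 0"
      by (simp only: cinner_add_right cinner_scaleC_right) simp
    then show ?thesis
      by simp
  qed
  moreover have "v \<in> ?T"
    unfolding v_def using vw(1) sub dT
    by (intro complex_vector.span_add complex_vector.span_scale) auto
  ultimately show ?case by blast
qed

context
  fixes S :: "'a::complex_inner set"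
  assumes S: "fin_dim_subspace S"
begin

lemma fin_dim_subspaceD: "complex_vector.subspace S"
  using S by (auto simp: fin_dim_subspace_def complex_vector.subspace_span)

text \<open>
  Two orthogonal decompositions of \<open>w\<close> differ by a vector orthogonal to itself. This makes the
  definite description in \<^const>\<open>orth_proj\<close> meaningful, and from here on the projection is used
  only through its characterization.
\<close>

lemma orth_proj_unique:
  assumes "v \<in> S" "\<And>u. u \<in> S \<Longrightarrow> cinner (w - v) u = 0"
  shows "orth_proj S w = v"
  unfolding orth_proj_def
proof (rule the_equality)
  fix v' assume v': "v' \<in> S \<and> (\<forall>u\<in>S. cinner (w - v') u = 0)"
  have "v - v' \<in> S"
    using assms v' by (simp add: complex_vector.subspace_diff fin_dim_subspaceD)
  then have "cinner (v - v') (v - v') = 0"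
    using assms(2)[of "v - v'"] v' cinner_diff_left[of "w - v'" "w - v" "v - v'"] by simp
  then show "v' = v"
    by (simp add: cinner_eq_zero_iff)
qed (use assms in auto)

lemma orth_proj_in: "orth_proj S w \<in> S"
  and orth_proj_orthogonal: "u \<in> S \<Longrightarrow> cinner (w - orth_proj S w) u = 0"
proof -
  obtain B where "finite B" "S = complex_vector.span B"
    using S by (auto simp: fin_dim_subspace_def)
  then obtain v where "v \<in> S" "\<And>u. u \<in> S \<Longrightarrow> cinner (w - v) u = 0"
    using orthogonal_decomposition_span[of B w] by blast
  with orth_proj_unique[of v w] show "orth_proj S w \<in> S" "u \<in> S \<Longrightarrow> cinner (w - orth_proj S w) u = 0"
    by auto
qed

lemma orth_proj_ident: "w \<in> S \<Longrightarrow> orth_proj S w = w"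
  by (rule orth_proj_unique) simp_all

lemma cinner_orth_proj_left: "u \<in> S \<Longrightarrow> cinner (orth_proj S w) u = cinner w u"
  using orth_proj_orthogonal[of u w] by (simp add: cinner_simps)

lemma cinner_orth_proj_right: "u \<in> S \<Longrightarrow> cinner u (orth_proj S w) = cinner u w"
  by (simp add: cinner_commute[of u] cinner_orth_proj_left)

lemma cinner_extensional_subspace:
  assumes "v \<in> S" "w \<in> S" "\<And>u. u \<in> S \<Longrightarrow> cinner v u = cinner w u"
  shows "v = w"
proof -
  have "v - w \<in> S"
    using assms by (simp add: complex_vector.subspace_diff fin_dim_subspaceD)
  then have "cinner (v - w) (v - w) = 0"
    using assms(3)[of "v - w"] by (simp add: cinner_diff_left)
  then show ?thesis
    by (simp add: cinner_eq_zero_iff)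
qed

lemma bounded_op_orth_proj: "bounded_op UNIV S (orth_proj S)"
proof -
  note sub = fin_dim_subspaceD
  have "orth_proj S (v + w) = orth_proj S v + orth_proj S w" for v w
    by (rule orth_proj_unique)
      (simp_all add: orth_proj_in sub complex_vector.subspace_add cinner_simps cinner_orth_proj_left)
  moreover have "orth_proj S (c *\<^sub>C w) = c *\<^sub>C orth_proj S w" for c w
    by (rule orth_proj_unique)
      (simp_all add: orth_proj_in sub complex_vector.subspace_scale cinner_simps cinner_orth_proj_left)
  moreover have "cnorm (orth_proj S w) \<le> 1 * cnorm w" for w
  proof -
    let ?v = "orth_proj S w"
    have e: "cinner w ?v = complex_of_real ((cnorm ?v)\<^sup>2)"
      by (simp only: cinner_self_of_real[symmetric] cinner_orth_proj_left[OF orth_proj_in])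
    have "(cnorm ?v)\<^sup>2 = cmod (cinner w ?v)"
      unfolding e norm_of_real by simp
    also have "\<dots> \<le> cnorm w * cnorm ?v"
      by (rule Cauchy_Schwarz_cinner)
    finally have "cnorm ?v * cnorm ?v \<le> cnorm w * cnorm ?v"
      by (simp add: power2_eq_square)
    then show ?thesis
      by (cases "?v = 0") (simp_all add: mult_le_cancel_right less_le)
  qed
  ultimately show ?thesis
    unfolding bounded_op_def using orth_proj_in by blast
qed

end

lemma fin_dim_subspace_subset:
  assumes "fin_dim_subspace W" "V \<subseteq> W" "complex_vector.subspace V"
  shows "fin_dim_subspace V"
proof -
  obtain C where C: "finite C" "W = complex_vector.span C"
    using assms by (auto simp: fin_dim_subspace_def)
  obtain B where B: "B \<subseteq> V" "complex_vector.independent B" "V \<subseteq> complex_vector.span B"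
    using complex_vector.maximal_independent_subset by blast
  have "B \<subseteq> complex_vector.span C"
    using B(1) assms(2) C(2) by blast
  then have "finite B"
    using complex_vector.independent_span_bound[OF C(1) B(2)] by blast
  moreover have "complex_vector.span B \<subseteq> V"
    by (rule complex_vector.span_minimal[OF B(1) assms(3)])
  then have "V = complex_vector.span B"
    using B(3) by blast
  ultimately show ?thesis
    by (auto simp: fin_dim_subspace_def)
qed

section \<open>Algebra of bounded operators\<close>

lemma bounded_opI:
  assumes "\<And>x. x \<in> X \<Longrightarrow> T x \<in> Y" "\<And>x y. \<lbrakk>x \<in> X; y \<in> X\<rbrakk> \<Longrightarrow> T (x + y) = T x + T y"
    "\<And>c x. x \<in> X \<Longrightarrow> T (c *\<^sub>C x) = c *\<^sub>C T x" "\<And>x. x \<in> X \<Longrightarrow> cnorm (T x) \<le> K * cnorm x"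
  shows "bounded_op X Y T"
  unfolding bounded_op_def using assms(1-3) by (intro conjI exI[of _ K]) (auto intro: assms(4))

lemma bounded_op_mono: "bounded_op X Y T \<Longrightarrow> X' \<subseteq> X \<Longrightarrow> bounded_op X' Y T"
  unfolding bounded_op_def by blast

lemma bounded_op_add:
  assumes S: "bounded_op X Y S" and T: "bounded_op X Y T" and Y: "complex_vector.subspace Y"
  shows "bounded_op X Y (\<lambda>x. S x + T x)"
proof -
  obtain K where K: "\<And>x. x \<in> X \<Longrightarrow> cnorm (S x) \<le> K * cnorm x"
    using bounded_op_bound[OF S] by auto
  obtain L where L: "\<And>x. x \<in> X \<Longrightarrow> cnorm (T x) \<le> L * cnorm x"
    using bounded_op_bound[OF T] by auto
  show ?thesis
  proof (rule bounded_opI)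
    show "cnorm (S x + T x) \<le> (K + L) * cnorm x" if "x \<in> X" for x
      using K[OF that] L[OF that] cnorm_triangle[of "S x" "T x"] by (simp add: distrib_right)
    show "S x + T x \<in> Y" if "x \<in> X" for x
      by (rule complex_vector.subspace_add[OF Y bounded_opD(1)[OF S that] bounded_opD(1)[OF T that]])
    show "S (x + y) + T (x + y) = S x + T x + (S y + T y)" if "x \<in> X" "y \<in> X" for x y
      by (simp only: bounded_opD(2)[OF S that] bounded_opD(2)[OF T that] add_ac)
    show "S (c *\<^sub>C x) + T (c *\<^sub>C x) = c *\<^sub>C (S x + T x)" if "x \<in> X" for c x
      by (simp only: bounded_opD(3)[OF S that] bounded_opD(3)[OF T that] scaleC_add_right)
  qed
qed

lemma bounded_op_scaleC:
  assumes T: "bounded_op X Y T" and Y: "complex_vector.subspace Y"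
  shows "bounded_op X Y (\<lambda>x. c *\<^sub>C T x)"
proof -
  obtain K where K: "\<And>x. x \<in> X \<Longrightarrow> cnorm (T x) \<le> K * cnorm x"
    using bounded_op_bound[OF T] by auto
  show ?thesis
  proof (rule bounded_opI)
    show "cnorm (c *\<^sub>C T x) \<le> (cmod c * K) * cnorm x" if "x \<in> X" for x
      using K[OF that] by (simp add: cnorm_scaleC mult_left_mono mult.assoc)
    show "c *\<^sub>C T x \<in> Y" if "x \<in> X" for x
      by (rule complex_vector.subspace_scale[OF Y bounded_opD(1)[OF T that]])
    show "c *\<^sub>C T (x + y) = c *\<^sub>C T x + c *\<^sub>C T y" if "x \<in> X" "y \<in> X" for x y
      by (simp only: bounded_opD(2)[OF T that] scaleC_add_right)
    show "c *\<^sub>C T (d *\<^sub>C x) = d *\<^sub>C c *\<^sub>C T x" if "x \<in> X" for d x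
      by (simp only: bounded_opD(3)[OF T that] scaleC_scaleC mult.commute[of c d])
  qed
qed

lemma bounded_op_comp:
  assumes T: "bounded_op X Y T" and S: "bounded_op Y Z S"
  shows "bounded_op X Z (\<lambda>x. S (T x))"
proof -
  obtain K where K: "\<And>x. x \<in> X \<Longrightarrow> cnorm (T x) \<le> K * cnorm x"
    using bounded_op_bound[OF T] by auto
  obtain L where L: "L \<ge> 0" "\<And>x. x \<in> Y \<Longrightarrow> cnorm (S x) \<le> L * cnorm x"
    using bounded_op_bound[OF S] by auto
  show ?thesis
  proof (rule bounded_opI)
    show "cnorm (S (T x)) \<le> (L * K) * cnorm x" if "x \<in> X" for x
      using L(2)[OF bounded_opD(1)[OF T that]] mult_left_mono[OF K[OF that] L(1)]
      by (simp add: mult.assoc)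
    show "S (T x) \<in> Z" if "x \<in> X" for x
      by (rule bounded_opD(1)[OF S bounded_opD(1)[OF T that]])
    show "S (T (x + y)) = S (T x) + S (T y)" if "x \<in> X" "y \<in> X" for x y
      using that by (simp only: bounded_opD[OF T] bounded_opD(2)[OF S])
    show "S (T (c *\<^sub>C x)) = c *\<^sub>C S (T x)" if "x \<in> X" for c x
      using that by (simp only: bounded_opD[OF T] bounded_opD(3)[OF S])
  qed
qed

lemma bounded_op_zero: "complex_vector.subspace Y \<Longrightarrow> bounded_op X Y (\<lambda>x. 0)"
  by (rule bounded_opI[where K = 0]) (simp_all add: complex_vector.subspace_0)

lemma bounded_op_sum:
  assumes "\<And>i. i \<in> A \<Longrightarrow> bounded_op X Y (T i)" "complex_vector.subspace Y"
  shows "bounded_op X Y (\<lambda>x. \<Sum>i\<in>A. T i x)"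
  using assms
  by (induction A rule: infinite_finite_induct) (simp_all add: bounded_op_add bounded_op_zero)

section \<open>Polynomials and linear functionals on them\<close>

definition additive_family :: "('i \<Rightarrow> 'a::ab_group_add \<Rightarrow> 'b::ab_group_add) \<Rightarrow> bool" where
  "additive_family s \<longleftrightarrow> (\<forall>i a b. s i (a + b) = s i a + s i b)"

text \<open>
  A family of additive maps \<open>s\<close>, one for every monomial, gives an additive map on polynomials.
  Evaluation at a point, the substitution of commuting operators, and the pairings of Bezout
  matrices with vectors are all of this form.
\<close>

definition weighted_sum :: "('i \<Rightarrow> 'a::ab_group_add \<Rightarrow> 'b::ab_group_add) \<Rightarrow> ('i \<Rightarrow>\<^sub>0 'a) \<Rightarrow> 'b" where
  "weighted_sum s Q = (\<Sum>i\<in>Poly_Mapping.keys Q. s i (Poly_Mapping.lookup Q i))"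

lemma additive_familyD:
  assumes "additive_family s"
  shows "s i (a + b) = s i a + s i b" "s i 0 = 0" "s i (- a) = - s i a" "s i (a - b) = s i a - s i b"
proof -
  show add: "s i (a + b) = s i a + s i b" for a b
    using assms by (simp add: additive_family_def)
  show z: "s i 0 = 0"
    using add[of 0 0] by simp
  show m: "s i (- a) = - s i a" for a
    using add[of a "- a"] z by (simp add: eq_neg_iff_add_eq_0 add.commute)
  show "s i (a - b) = s i a - s i b"
    using add[of a "- b"] m by simp
qed

lemma poly_mapping_sum_single:
  "(\<Sum>i\<in>Poly_Mapping.keys Q. Poly_Mapping.single i (Poly_Mapping.lookup Q i)) = Q"
  by (rule poly_mapping_eqI)
    (simp add: lookup_sum lookup_single when_def in_keys_iff sum.delta cong: if_cong)

lemma poly_mapping_add_induct [case_names zero single add]: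
  fixes Q :: "'i \<Rightarrow>\<^sub>0 'b::comm_monoid_add"
  assumes "P 0" "\<And>k v. P (Poly_Mapping.single k v)" "\<And>F G. P F \<Longrightarrow> P G \<Longrightarrow> P (F + G)"
  shows "P Q"
proof -
  have "P (\<Sum>i\<in>A. Poly_Mapping.single i (Poly_Mapping.lookup Q i))" if "finite A" for A
    using that by (induction A) (simp_all add: assms)
  from this[of "Poly_Mapping.keys Q"] show ?thesis
    by (simp add: poly_mapping_sum_single)
qed

context
  fixes s :: "'i \<Rightarrow> 'a::ab_group_add \<Rightarrow> 'b::ab_group_add"
  assumes s: "additive_family s"
begin

lemma weighted_sum_superset:
  assumes "finite S" "Poly_Mapping.keys Q \<subseteq> S"
  shows "weighted_sum s Q = (\<Sum>i\<in>S. s i (Poly_Mapping.lookup Q i))"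
  unfolding weighted_sum_def using assms
  by (intro sum.mono_neutral_left) (auto simp: in_keys_iff additive_familyD[OF s])

lemma weighted_sum_add: "weighted_sum s (P + Q) = weighted_sum s P + weighted_sum s Q"
proof -
  let ?S = "Poly_Mapping.keys P \<union> Poly_Mapping.keys Q"
  have "Poly_Mapping.keys (P + Q) \<subseteq> ?S"
    by (rule keys_add)
  then show ?thesis
    by (simp add: weighted_sum_superset[of ?S] lookup_add additive_familyD[OF s] sum.distrib)
qed

lemma weighted_sum_zero [simp]: "weighted_sum s 0 = 0"
  by (simp add: weighted_sum_def)

lemma weighted_sum_minus: "weighted_sum s (- Q) = - weighted_sum s Q"
  using weighted_sum_add[of Q "- Q"] by (simp add: eq_neg_iff_add_eq_0 add.commute)

lemma weighted_sum_diff: "weighted_sum s (P - Q) = weighted_sum s P - weighted_sum s Q"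
  using weighted_sum_add[of P "- Q"] by (simp add: weighted_sum_minus)

lemma weighted_sum_sum: "weighted_sum s (sum f A) = (\<Sum>a\<in>A. weighted_sum s (f a))"
  by (induction A rule: infinite_finite_induct) (simp_all add: weighted_sum_add)

lemma weighted_sum_single [simp]: "weighted_sum s (Poly_Mapping.single i a) = s i a"
  by (cases "a = 0") (simp_all add: weighted_sum_def additive_familyD[OF s])

end

lemma weighted_sum_mult:
  fixes s :: "'i::comm_monoid_add \<Rightarrow> 'a::comm_ring \<Rightarrow> 'b::ab_group_add"
  assumes s: "additive_family s"
  shows "weighted_sum s (P * Q) = weighted_sum (\<lambda>i a. weighted_sum (\<lambda>j b. s (i + j) (a * b)) Q) P"
proof -
  have "P * Q = (\<Sum>i\<in>Poly_Mapping.keys P. Poly_Mapping.single i (Poly_Mapping.lookup P i))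
      * (\<Sum>j\<in>Poly_Mapping.keys Q. Poly_Mapping.single j (Poly_Mapping.lookup Q j))"
    by (simp only: poly_mapping_sum_single)
  also have "\<dots> = (\<Sum>i\<in>Poly_Mapping.keys P. \<Sum>j\<in>Poly_Mapping.keys Q.
      Poly_Mapping.single (i + j) (Poly_Mapping.lookup P i * Poly_Mapping.lookup Q j))"
    by (simp only: sum_product mult_single)
  finally show ?thesis
    by (simp add: weighted_sum_sum[OF s] weighted_sum_single[OF s])
      (simp add: weighted_sum_def)
qed

lemma weighted_sum_mult_single:
  fixes s :: "'i::comm_monoid_add \<Rightarrow> 'a::comm_ring \<Rightarrow> 'b::ab_group_add"
  assumes s: "additive_family s"
  shows "weighted_sum s (Poly_Mapping.single i a * Q) = weighted_sum (\<lambda>j b. s (i + j) (a * b)) Q"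
proof -
  have "additive_family (\<lambda>i a. weighted_sum (\<lambda>j b. s (i + j) (a * b)) Q)"
    by (simp add: additive_family_def weighted_sum_def distrib_right additive_familyD[OF s] sum.distrib)
  then show ?thesis
    by (simp add: weighted_sum_mult[OF s])
qed

lemma lookup_single_mult_add:
  fixes Q :: "'i::cancel_comm_monoid_add \<Rightarrow>\<^sub>0 'a::comm_ring"
  shows "Poly_Mapping.lookup (Poly_Mapping.single k a * Q) (k + l) = a * Poly_Mapping.lookup Q l"
proof -
  let ?s = "\<lambda>i b. if i = k + l then b else (0::'a)"
  have fam: "additive_family ?s"
    by (simp add: additive_family_def)
  have look: "weighted_sum ?s P = Poly_Mapping.lookup P (k + l)" for P
    by (simp add: weighted_sum_def sum.delta' in_keys_iff)
  show ?thesis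
    unfolding look[symmetric] weighted_sum_mult_single[OF fam]
    by (simp add: weighted_sum_def sum.delta' in_keys_iff)
qed

lemma lookup_single_mult_other:
  fixes Q :: "'i::cancel_comm_monoid_add \<Rightarrow>\<^sub>0 'a::comm_ring"
  assumes "\<And>l. m \<noteq> k + l"
  shows "Poly_Mapping.lookup (Poly_Mapping.single k a * Q) m = 0"
proof -
  let ?s = "\<lambda>i b. if i = m then b else (0::'a)"
  have fam: "additive_family ?s"
    by (simp add: additive_family_def)
  have look: "weighted_sum ?s P = Poly_Mapping.lookup P m" for P
    by (simp add: weighted_sum_def sum.delta' in_keys_iff)
  show ?thesis
    unfolding look[symmetric] weighted_sum_mult_single[OF fam]
    using assms[THEN not_sym] by (simp add: weighted_sum_def)
qed

lemma lookup_const_mult: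
  fixes Q :: "'i::cancel_comm_monoid_add \<Rightarrow>\<^sub>0 'a::comm_ring"
  shows "Poly_Mapping.lookup (Poly_Mapping.single 0 a * Q) l = a * Poly_Mapping.lookup Q l"
  using lookup_single_mult_add[of 0 a Q l] by simp

text \<open>
  The value at \<open>(x1, x2)\<close>, where the ring homomorphism \<open>h\<close> interprets the coefficients. Polynomials
  in \<open>(x1, x2)\<close> with coefficients in the polynomials in \<open>(y1, y2)\<close> are evaluated by iterating this.
\<close>

definition eval_poly :: "('r::comm_ring_1 \<Rightarrow> 's::comm_ring_1) \<Rightarrow> 's \<Rightarrow> 's \<Rightarrow> 'r poly2 \<Rightarrow> 's" where
  "eval_poly h x1 x2 = weighted_sum (\<lambda>k c. h c * (x1 ^ fst k * x2 ^ snd k))"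

context
  fixes h :: "'r::comm_ring_1 \<Rightarrow> 's::comm_ring_1"
  assumes h_add: "\<And>a b. h (a + b) = h a + h b" and h_mult: "\<And>a b. h (a * b) = h a * h b"
begin

lemma additive_family_eval_poly: "additive_family (\<lambda>k c. h c * (x1 ^ fst k * x2 ^ snd k))"
  by (simp add: additive_family_def h_add distrib_right)

lemma eval_poly_add: "eval_poly h x1 x2 (P + Q) = eval_poly h x1 x2 P + eval_poly h x1 x2 Q"
  and eval_poly_diff: "eval_poly h x1 x2 (P - Q) = eval_poly h x1 x2 P - eval_poly h x1 x2 Q"
  and eval_poly_sum: "eval_poly h x1 x2 (sum f A) = (\<Sum>a\<in>A. eval_poly h x1 x2 (f a))"
  and eval_poly_single: "eval_poly h x1 x2 (Poly_Mapping.single k a) = h a * (x1 ^ fst k * x2 ^ snd k)"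
  unfolding eval_poly_def
  by (rule weighted_sum_add weighted_sum_diff weighted_sum_sum weighted_sum_single
      additive_family_eval_poly)+

lemma eval_poly_mult: "eval_poly h x1 x2 (P * Q) = eval_poly h x1 x2 P * eval_poly h x1 x2 Q"
  unfolding eval_poly_def weighted_sum_mult[OF additive_family_eval_poly]
  by (simp add: weighted_sum_def sum_product h_mult power_add mult_ac)

end

lemma polynomial_function_coeffs_0:
  fixes c :: "nat \<times> nat \<Rightarrow> complex"
  assumes fin: "finite S" and zero: "\<And>x1 x2. (\<Sum>k\<in>S. c k * (x1 ^ fst k * x2 ^ snd k)) = 0"
    and "k \<in> S"
  shows "c k = 0"
proof -
  define N where "N = Max (fst ` S \<union> snd ` S)"
  have N: "fst k \<le> N" "snd k \<le> N" if "k \<in> S" for k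
    unfolding N_def using fin that by (auto intro!: Max_ge)
  define f where "f a b = (if (a, b) \<in> S then c (a, b) else 0)" for a b
  have "(\<Sum>a\<le>N. (\<Sum>b\<le>N. f a b * x2 ^ b) * x1 ^ a) = 0" for x1 x2
  proof -
    have "(\<Sum>a\<le>N. (\<Sum>b\<le>N. f a b * x2 ^ b) * x1 ^ a)
        = (\<Sum>k\<in>{..N}\<times>{..N}. f (fst k) (snd k) * (x1 ^ fst k * x2 ^ snd k))"
      by (simp add: sum.cartesian_product sum_distrib_left sum_distrib_right case_prod_beta mult_ac)
    also have "\<dots> = (\<Sum>k\<in>S. c k * (x1 ^ fst k * x2 ^ snd k))"
    proof (rule sum.mono_neutral_cong_right)
      show "S \<subseteq> {..N} \<times> {..N}"
        using N by (auto simp: mem_Times_iff)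
    qed (auto simp: f_def)
    finally show ?thesis
      by (simp add: zero)
  qed
  then have inner: "(\<Sum>b\<le>N. f a b * x2 ^ b) = 0" if "a \<le> N" for a x2
    using polyfun_eq_0[of "\<lambda>a. \<Sum>b\<le>N. f a b * x2 ^ b" N] that by simp
  have "f a b = 0" if "a \<le> N" "b \<le> N" for a b
    using polyfun_eq_0[of "f a" N] inner[OF that(1)] that(2) by simp
  from this[of "fst k" "snd k"] show ?thesis
    using N[OF \<open>k \<in> S\<close>] \<open>k \<in> S\<close> by (simp add: f_def)
qed

abbreviation eval4 :: "complex \<Rightarrow> complex \<Rightarrow> complex \<Rightarrow> complex \<Rightarrow> complex poly2 poly2 \<Rightarrow> complex" where
  "eval4 x1 x2 y1 y2 \<equiv> eval_poly (eval_poly (\<lambda>c. c) y1 y2) x1 x2"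

lemma eval_poly_vanishing_coeff:
  fixes h :: "'r::comm_ring_1 \<Rightarrow> complex"
  assumes "\<And>x1 x2. eval_poly h x1 x2 Q = 0" "k \<in> Poly_Mapping.keys Q"
  shows "h (Poly_Mapping.lookup Q k) = 0"
  by (rule polynomial_function_coeffs_0[of "Poly_Mapping.keys Q" "\<lambda>k. h (Poly_Mapping.lookup Q k)" k])
    (use assms in \<open>simp_all add: eval_poly_def weighted_sum_def\<close>)

lemma eval4_eq_0_imp_0:
  assumes "\<And>x1 x2 y1 y2. eval4 x1 x2 y1 y2 Q = 0"
  shows "Q = 0"
proof (rule ccontr)
  assume "Q \<noteq> 0"
  then obtain k where k: "k \<in> Poly_Mapping.keys Q"
    using keys_eq_empty by blast
  then have "Poly_Mapping.lookup Q k \<noteq> 0"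
    by (simp add: in_keys_iff)
  then obtain l where "l \<in> Poly_Mapping.keys (Poly_Mapping.lookup Q k)"
    using keys_eq_empty by blast
  moreover have "eval_poly (\<lambda>c. c) y1 y2 (Poly_Mapping.lookup Q k) = 0" for y1 y2
    by (rule eval_poly_vanishing_coeff[OF assms k])
  ultimately show False
    using eval_poly_vanishing_coeff[of "\<lambda>c. c" "Poly_Mapping.lookup Q k" l] by (simp add: in_keys_iff)
qed

lemma eval_poly_one [simp]: "eval_poly (\<lambda>c. c) y1 y2 1 = 1"
  using eval_poly_single[of "\<lambda>c. c" y1 y2 0 1] by simp

lemma eval4_simps:
  "eval4 x1 x2 y1 y2 (P + Q) = eval4 x1 x2 y1 y2 P + eval4 x1 x2 y1 y2 Q"
  "eval4 x1 x2 y1 y2 (P - Q) = eval4 x1 x2 y1 y2 P - eval4 x1 x2 y1 y2 Q"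
  "eval4 x1 x2 y1 y2 (P * Q) = eval4 x1 x2 y1 y2 P * eval4 x1 x2 y1 y2 Q"
  "eval4 x1 x2 y1 y2 (sum f A) = (\<Sum>a\<in>A. eval4 x1 x2 y1 y2 (f a))"
  "eval4 x1 x2 y1 y2 (Poly_Mapping.single k r) = eval_poly (\<lambda>c. c) y1 y2 r * (x1 ^ fst k * x2 ^ snd k)"
  by (simp_all add: eval_poly_add eval_poly_diff eval_poly_mult eval_poly_sum eval_poly_single)

section \<open>Syzygies of the minors of two points\<close>

text \<open>
  The variables and the constants. The exponent is written with \<open>Suc 0\<close> because that is the form
  which the simplifier gives to it.
\<close>

abbreviation mX1 :: "'r::comm_ring_1 poly2" where "mX1 \<equiv> Poly_Mapping.single (Suc 0, 0) 1"
abbreviation mX2 :: "'r::comm_ring_1 poly2" where "mX2 \<equiv> Poly_Mapping.single (0, Suc 0) 1"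
abbreviation mC :: "'r \<Rightarrow> 'r::comm_ring_1 poly2" where "mC \<equiv> Poly_Mapping.single 0"

lemma lookup_X1_mult [simp]:
  fixes Q :: "'r::comm_ring_1 poly2"
  shows "Poly_Mapping.lookup (mX1 * Q) (Suc a, b) = Poly_Mapping.lookup Q (a, b)"
    and "Poly_Mapping.lookup (mX1 * Q) (0, b) = 0"
  using lookup_single_mult_add[of "(Suc 0, 0)" 1 Q "(a, b)"]
    lookup_single_mult_other[of "(0, b)" "(Suc 0, 0)" 1 Q]
  by (simp_all add: split_paired_all)

lemma lookup_X2_mult [simp]:
  fixes Q :: "'r::comm_ring_1 poly2"
  shows "Poly_Mapping.lookup (mX2 * Q) (a, Suc b) = Poly_Mapping.lookup Q (a, b)"
    and "Poly_Mapping.lookup (mX2 * Q) (a, 0) = 0"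
  using lookup_single_mult_add[of "(0, Suc 0)" 1 Q "(a, b)"]
    lookup_single_mult_other[of "(a, 0)" "(0, Suc 0)" 1 Q]
  by (simp_all add: split_paired_all)

text \<open>
  A polynomial that is monic in one variable shifts the leading term. Taken with three different
  weights this gives that \<open>x\<^sub>1 - y\<^sub>1\<close> and \<open>x\<^sub>2 - y\<^sub>2\<close> cannot annihilate a nonzero polynomial, over any
  commutative coefficient ring, and it bounds the total degree of a quotient by \<open>x\<^sub>1 - y\<^sub>1\<close>.
\<close>

lemma monic_multiple_leading_key:
  fixes g :: "'i::cancel_comm_monoid_add \<Rightarrow>\<^sub>0 'r::comm_ring_1" and wt :: "'i \<Rightarrow> nat"
  assumes wt: "\<And>k. wt (e + k) = Suc (wt k)" and "g \<noteq> 0"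
  shows "\<exists>k\<in>Poly_Mapping.keys g. (\<forall>l\<in>Poly_Mapping.keys g. wt l \<le> wt k) \<and>
    e + k \<in> Poly_Mapping.keys ((Poly_Mapping.single e 1 - Poly_Mapping.single 0 y) * g)"
proof -
  have "Poly_Mapping.keys g \<noteq> {}"
    using \<open>g \<noteq> 0\<close> by simp
  then have "Max (wt ` Poly_Mapping.keys g) \<in> wt ` Poly_Mapping.keys g"
    by (intro Max_in) simp_all
  then obtain k where k: "k \<in> Poly_Mapping.keys g" and Max: "Max (wt ` Poly_Mapping.keys g) = wt k"
    by blast
  have le: "wt l \<le> wt k" if "l \<in> Poly_Mapping.keys g" for l
    unfolding Max[symmetric] using that by (intro Max_ge) simp_all
  have "e + k \<notin> Poly_Mapping.keys g"
    using le[of "e + k"] wt[of k] by auto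
  then have "Poly_Mapping.lookup ((Poly_Mapping.single e 1 - Poly_Mapping.single 0 y) * g) (e + k)
      = Poly_Mapping.lookup g k"
    by (simp add: left_diff_distrib lookup_minus lookup_single_mult_add lookup_const_mult in_keys_iff)
  then show ?thesis
    using k le by (intro bexI[of _ k]) (simp_all add: in_keys_iff)
qed

text \<open>
  The remainder is \<open>F\<close> with \<open>y\<close> substituted for \<open>x\<^sub>1\<close>; what matters is only that it is free of \<open>x\<^sub>1\<close>.
\<close>

lemma division_by_X1_minus_const:
  fixes F :: "'r::comm_ring_1 poly2"
  shows "\<exists>c r. F = (mC y - mX1) * c + r \<and> (\<forall>k\<in>Poly_Mapping.keys r. fst k = 0)"
proof -
  have mono: "\<exists>c r. Poly_Mapping.single (a, b) v = (mC y - mX1) * c + r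
      \<and> (\<forall>k\<in>Poly_Mapping.keys r. fst k = 0)" for a b and v :: 'r
  proof (induction a)
    case 0
    have "Poly_Mapping.single (0, b) v = (mC y - mX1) * 0 + Poly_Mapping.single (0, b) v
        \<and> (\<forall>k\<in>Poly_Mapping.keys (Poly_Mapping.single (0::nat, b) v). fst k = 0)"
      by (auto split: if_splits)
    then show ?case by blast
  next
    case (Suc a)
    then obtain c r where cr: "Poly_Mapping.single (a, b) v = (mC y - mX1) * c + r"
      "\<forall>k\<in>Poly_Mapping.keys r. fst k = 0" by blast
    have "Poly_Mapping.single (Suc a, b) v = mX1 * Poly_Mapping.single (a, b) v"
      by (simp add: mult_single)
    also have "\<dots> = (mC y - mX1) * (mX1 * c - r) + mC y * r"
      unfolding cr by (simp add: algebra_simps)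
    finally have "Poly_Mapping.single (Suc a, b) v = (mC y - mX1) * (mX1 * c - r) + mC y * r" .
    moreover have "\<forall>k\<in>Poly_Mapping.keys (mC y * r). fst k = 0"
      using cr(2) by (auto simp: in_keys_iff lookup_const_mult)
    ultimately show ?case by blast
  qed
  show ?thesis
  proof (induction F rule: poly_mapping_add_induct)
    case zero
    show ?case
      by (intro exI[of _ 0]) simp
  next
    case (single k v)
    show ?case
      using mono[of "fst k" "snd k" v] by simp
  next
    case (add F G)
    then obtain c r c' r' where F: "F = (mC y - mX1) * c + r" "\<forall>k\<in>Poly_Mapping.keys r. fst k = 0"
      and G: "G = (mC y - mX1) * c' + r'" "\<forall>k\<in>Poly_Mapping.keys r'. fst k = 0"
      by blast
    have "F + G = (mC y - mX1) * (c + c') + (r + r')"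
      unfolding F(1) G(1) by (simp add: algebra_simps)
    moreover have "\<forall>k\<in>Poly_Mapping.keys (r + r'). fst k = 0"
      using F(2) G(2) keys_add[of r r'] by blast
    ultimately show ?case by blast
  qed
qed

text \<open>
  With \<open>x\<^sub>0 = y\<^sub>0 = 1\<close> the minors of \<open>x = (1, x\<^sub>1, x\<^sub>2)\<close> and \<open>y = (1, y\<^sub>1, y\<^sub>2)\<close> are \<open>x\<^sub>1y\<^sub>2 - x\<^sub>2y\<^sub>1\<close>,
  \<open>x\<^sub>2 - y\<^sub>2\<close> and \<open>y\<^sub>1 - x\<^sub>1\<close>, and the conclusion is the vector identity \<open>Q = x d + y c\<close>. Subtracting
  \<open>Q0 x\<close> from \<open>Q\<close> leaves a syzygy \<open>(0, F, G)\<close>, that is, \<open>F (x\<^sub>2 - y\<^sub>2) = G (x\<^sub>1 - y\<^sub>1)\<close>; hence \<open>x\<^sub>1 - y\<^sub>1\<close>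
  divides \<open>F\<close>. The variables \<open>y\<close> live in the coefficient ring, so that only division by polynomials
  monic in \<open>x\<close> is needed.
\<close>

lemma minors_syzygy:
  fixes Q0 Q1 Q2 :: "'r::comm_ring_1 poly2"
  assumes syzygy: "Q0 * (mX1 * mC y2 - mX2 * mC y1) + Q1 * (mX2 - mC y2) + Q2 * (mC y1 - mX1) = 0"
  obtains c d where "Q0 = d + c" "Q1 = mX1 * d + mC y1 * c" "Q2 = mX2 * d + mC y2 * c"
proof -
  define F where "F = Q1 - mX1 * Q0"
  define G where "G = Q2 - mX2 * Q0"
  obtain c r where c: "F = (mC y1 - mX1) * c + r" and r: "\<And>k. k \<in> Poly_Mapping.keys r \<Longrightarrow> fst k = 0"
    using division_by_X1_minus_const by blast
  have FG: "F * (mX2 - mC y2) + G * (mC y1 - mX1) = 0"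
    unfolding syzygy[symmetric] F_def G_def by (simp add: algebra_simps)
  define g where "g = c * (mX2 - mC y2) + G"
  have g: "(mX1 - mC y1) * g = (mX2 - mC y2) * r"
    using FG unfolding c g_def by (simp add: algebra_simps)
  have r0: "fst k = 0" if "k \<in> Poly_Mapping.keys ((mX2 - mC y2) * r)" for k
  proof (rule ccontr)
    assume "fst k \<noteq> 0"
    obtain a b where k: "k = (a, b)" by force
    have z: "Poly_Mapping.lookup r (a, b') = 0" for b'
      using r[of "(a, b')"] \<open>fst k \<noteq> 0\<close> by (auto simp: k in_keys_iff)
    have "Poly_Mapping.lookup ((mX2 - mC y2) * r) k = 0"
      by (cases b) (simp_all add: k z left_diff_distrib lookup_minus lookup_const_mult)
    with that show False
      by (simp add: in_keys_iff)
  qed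
  \<comment> \<open>The left side of the preceding equation has positive degree in \<open>x\<^sub>1\<close> unless \<open>g = 0\<close>,
    the right side has degree 0.\<close>
  have "g = 0"
  proof (rule ccontr)
    assume "g \<noteq> 0"
    then obtain k where "(Suc 0, 0) + k \<in> Poly_Mapping.keys ((mX1 - mC y1) * g)"
      using monic_multiple_leading_key[of fst "(Suc 0, 0)" g y1] by auto
    then show False
      unfolding g using r0 by fastforce
  qed
  have "r = 0"
  proof (rule ccontr)
    assume "r \<noteq> 0"
    then obtain k where "(0, Suc 0) + k \<in> Poly_Mapping.keys ((mX2 - mC y2) * r)"
      using monic_multiple_leading_key[of snd "(0, Suc 0)" r y2] by auto
    then show False
      unfolding g[symmetric] \<open>g = 0\<close> by simp
  qed
  show thesis
  proof (rule that[of "Q0 - c" c])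
    show "Q1 = mX1 * (Q0 - c) + mC y1 * c"
      using c \<open>r = 0\<close> unfolding F_def by (simp add: algebra_simps)
    show "Q2 = mX2 * (Q0 - c) + mC y2 * c"
      using \<open>g = 0\<close> unfolding g_def G_def by (simp add: algebra_simps)
  qed simp
qed

text \<open>
  If the \<open>Q\<close> have degree less than \<open>n\<close> in \<open>x\<close>, the cofactor \<open>d\<close> even has degree less than \<open>n - 1\<close>:
  a term of \<open>d\<close> in the top degree would survive, multiplied by \<open>x\<^sub>1\<close>, in \<open>Q1\<close>. This is the range in
  which the relations of the principal subspace are available.
\<close>

lemma minors_syzygy_keys:
  fixes Q0 Q1 Q2 :: "'r::comm_ring_1 poly2"
  assumes Q0: "Q0 = d + c" and Q1: "Q1 = mX1 * d + mC y1 * c"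
    and keys: "Poly_Mapping.keys Q0 \<subseteq> multi_indices n" "Poly_Mapping.keys Q1 \<subseteq> multi_indices n"
  shows "Poly_Mapping.keys c \<subseteq> multi_indices n" "Poly_Mapping.keys d \<subseteq> multi_indices (n - 1)"
proof -
  have look0: "Poly_Mapping.lookup Q0 (a, b) = 0" and look1: "Poly_Mapping.lookup Q1 (a, b) = 0"
    if "n \<le> a + b" for a b
    using that keys by (auto simp: multi_indices_def in_keys_iff)
  have X1: "(mX1 - mC y1) * c = mX1 * Q0 - Q1"
    unfolding Q0 Q1 by (simp add: algebra_simps)
  show c: "Poly_Mapping.keys c \<subseteq> multi_indices n"
  proof (cases "c = 0")
    case False
    obtain k where k: "\<forall>l\<in>Poly_Mapping.keys c. fst l + snd l \<le> fst k + snd k"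
      "(Suc 0, 0) + k \<in> Poly_Mapping.keys ((mX1 - mC y1) * c)"
      using monic_multiple_leading_key[of "\<lambda>k. fst k + snd k" "(Suc 0, 0)" c y1] False by auto
    have "fst k + snd k < n"
    proof (rule ccontr)
      assume "\<not> fst k + snd k < n"
      then have "Poly_Mapping.lookup ((mX1 - mC y1) * c) ((Suc 0, 0) + k) = 0"
        unfolding X1 by (cases k) (simp add: lookup_minus look0 look1)
      with k(2) show False
        by (simp add: in_keys_iff)
    qed
    then show ?thesis
      using k(1) by (fastforce simp: multi_indices_def)
  qed simp
  show "Poly_Mapping.keys d \<subseteq> multi_indices (n - 1)"
  proof (rule subsetI, rule ccontr)
    fix k assume k: "k \<in> Poly_Mapping.keys d" "k \<notin> multi_indices (n - 1)"
    obtain a b where ab: "k = (a, b)" by force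
    have "n \<le> Suc a + b"
      using k(2) by (auto simp: ab multi_indices_def)
    then have "Poly_Mapping.lookup Q1 (Suc a, b) = 0" "Poly_Mapping.lookup c (Suc a, b) = 0"
      using look1[of "Suc a" b] c by (auto simp: multi_indices_def in_keys_iff)
    then have "Poly_Mapping.lookup d (a, b) = 0"
      unfolding Q1 by (simp add: lookup_add lookup_const_mult)
    with k(1) show False
      by (simp add: ab in_keys_iff)
  qed
qed

text \<open>
  Bounds on the degree in \<open>y\<close> pass from the \<open>Q\<close> to the cofactors. \<open>D\<close> and \<open>D'\<close> stand for the
  coefficients of degree less than \<open>N\<close> and less than \<open>N - 1\<close>; without a bound both are the whole ring.
\<close>

lemma minors_syzygy_coeffs:
  fixes Q0 Q1 Q2 :: "'r::comm_ring_1 poly2"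
  assumes Q0: "Q0 = d + c" and Q1: "Q1 = mX1 * d + mC y1 * c"
    and coeffs: "\<And>k. Poly_Mapping.lookup Q0 k \<in> D" "\<And>k. Poly_Mapping.lookup Q1 k \<in> D"
    and add: "\<And>r s. \<lbrakk>r \<in> D; s \<in> D\<rbrakk> \<Longrightarrow> r + s \<in> D" and diff: "\<And>r s. \<lbrakk>r \<in> D; s \<in> D\<rbrakk> \<Longrightarrow> r - s \<in> D"
    and sub: "D' \<subseteq> D" and cancel: "\<And>r. y1 * r \<in> D \<Longrightarrow> r \<in> D'"
  shows "Poly_Mapping.lookup c k \<in> D'" "Poly_Mapping.lookup d k \<in> D"
proof -
  have X1: "mC y1 * c = mX1 * c + (Q1 - mX1 * Q0)"
    unfolding Q0 Q1 by (simp add: algebra_simps)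
  have "Poly_Mapping.lookup c (a, b) \<in> D'" for a b
  proof (induction a)
    case 0
    have "y1 * Poly_Mapping.lookup c (0, b) = Poly_Mapping.lookup Q1 (0, b)"
      using arg_cong[OF X1, of "\<lambda>P. Poly_Mapping.lookup P (0, b)"]
      by (simp add: lookup_const_mult lookup_add lookup_minus)
    then show ?case
      by (intro cancel) (simp add: coeffs)
  next
    case (Suc a)
    have "y1 * Poly_Mapping.lookup c (Suc a, b) =
        Poly_Mapping.lookup c (a, b) + (Poly_Mapping.lookup Q1 (Suc a, b) - Poly_Mapping.lookup Q0 (a, b))"
      using arg_cong[OF X1, of "\<lambda>P. Poly_Mapping.lookup P (Suc a, b)"]
      by (simp add: lookup_const_mult lookup_add lookup_minus)
    also have "\<dots> \<in> D"
      using Suc sub coeffs by (intro add diff) auto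
    finally show ?case
      by (rule cancel)
  qed
  then have c: "Poly_Mapping.lookup c k \<in> D'" for k
    by (cases k) simp
  then show "Poly_Mapping.lookup c k \<in> D'" .
  have "Poly_Mapping.lookup d k = Poly_Mapping.lookup Q0 k - Poly_Mapping.lookup c k"
    unfolding Q0 by (simp add: lookup_add)
  also have "\<dots> \<in> D"
    by (intro diff coeffs(1) subsetD[OF sub c])
  finally show "Poly_Mapping.lookup d k \<in> D" .
qed

text \<open>
  The maps \<open>s0\<close>, \<open>s1\<close>, \<open>s2\<close> represent pairings with \<open>\<gamma>in\<close>, \<open>\<sigma>2\<close> and \<open>-\<sigma>1\<close>. The hypotheses \<open>left\<close> and
  \<open>right\<close> say that they annihilate \<open>x d\<close> and \<open>y c\<close>, so by the description of the syzygies they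
  annihilate every \<open>Q\<close>.
\<close>

theorem pairing_vanishes:
  fixes Q0 Q1 Q2 :: "'r::comm_ring_1 poly2" and s0 s1 s2 :: "nat \<times> nat \<Rightarrow> 'r \<Rightarrow> 'b::ab_group_add"
  assumes syzygy: "Q0 * (mX1 * mC y2 - mX2 * mC y1) + Q1 * (mX2 - mC y2) + Q2 * (mC y1 - mX1) = 0"
    and keys: "Poly_Mapping.keys Q0 \<subseteq> multi_indices n" "Poly_Mapping.keys Q1 \<subseteq> multi_indices n"
    and coeffs: "\<And>k. Poly_Mapping.lookup Q0 k \<in> D" "\<And>k. Poly_Mapping.lookup Q1 k \<in> D"
    and add: "\<And>r s. \<lbrakk>r \<in> D; s \<in> D\<rbrakk> \<Longrightarrow> r + s \<in> D" and diff: "\<And>r s. \<lbrakk>r \<in> D; s \<in> D\<rbrakk> \<Longrightarrow> r - s \<in> D"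
    and sub: "D' \<subseteq> D" and cancel: "\<And>r. y1 * r \<in> D \<Longrightarrow> r \<in> D'"
    and s: "additive_family s0" "additive_family s1" "additive_family s2"
    and left: "\<And>a b r. \<lbrakk>Suc (a + b) < n; r \<in> D\<rbrakk> \<Longrightarrow> s0 (a, b) r + s1 (Suc a, b) r + s2 (a, Suc b) r = 0"
    and right: "\<And>a b r. \<lbrakk>a + b < n; r \<in> D'\<rbrakk> \<Longrightarrow> s0 (a, b) r + s1 (a, b) (y1 * r) + s2 (a, b) (y2 * r) = 0"
  shows "weighted_sum s0 Q0 + weighted_sum s1 Q1 + weighted_sum s2 Q2 = 0"
proof -
  obtain c d where Q: "Q0 = d + c" "Q1 = mX1 * d + mC y1 * c" "Q2 = mX2 * d + mC y2 * c"
    using minors_syzygy[OF syzygy] by blast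
  note c_keys = minors_syzygy_keys(1)[OF Q(1,2) keys] and d_keys = minors_syzygy_keys(2)[OF Q(1,2) keys]
  note c_coeff = minors_syzygy_coeffs(1)[OF Q(1,2) coeffs add diff sub cancel]
    and d_coeff = minors_syzygy_coeffs(2)[OF Q(1,2) coeffs add diff sub cancel]
  have "weighted_sum s0 d + weighted_sum s1 (mX1 * d) + weighted_sum s2 (mX2 * d) = 0"
  proof -
    have "weighted_sum s0 d + weighted_sum s1 (mX1 * d) + weighted_sum s2 (mX2 * d)
      = (\<Sum>k\<in>Poly_Mapping.keys d. s0 k (Poly_Mapping.lookup d k)
          + s1 ((Suc 0, 0) + k) (Poly_Mapping.lookup d k) + s2 ((0, Suc 0) + k) (Poly_Mapping.lookup d k))"
      by (simp add: weighted_sum_mult_single s) (simp add: weighted_sum_def sum.distrib)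
    also have "\<dots> = 0"
    proof (intro sum.neutral ballI)
      fix k assume "k \<in> Poly_Mapping.keys d"
      then have "k \<in> multi_indices (n - 1)"
        using d_keys by blast
      then show "s0 k (Poly_Mapping.lookup d k)
          + s1 ((Suc 0, 0) + k) (Poly_Mapping.lookup d k) + s2 ((0, Suc 0) + k) (Poly_Mapping.lookup d k) = 0"
        using left[OF _ d_coeff] by (cases k) (simp add: multi_indices_def)
    qed
    finally show ?thesis .
  qed
  moreover have "weighted_sum s0 c + weighted_sum s1 (mC y1 * c) + weighted_sum s2 (mC y2 * c) = 0"
  proof -
    have "weighted_sum s0 c + weighted_sum s1 (mC y1 * c) + weighted_sum s2 (mC y2 * c)
      = (\<Sum>k\<in>Poly_Mapping.keys c. s0 k (Poly_Mapping.lookup c k)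
          + s1 k (y1 * Poly_Mapping.lookup c k) + s2 k (y2 * Poly_Mapping.lookup c k))"
      by (simp add: weighted_sum_mult_single s) (simp add: weighted_sum_def sum.distrib)
    also have "\<dots> = 0"
    proof (intro sum.neutral ballI)
      fix k assume "k \<in> Poly_Mapping.keys c"
      then have "k \<in> multi_indices n"
        using c_keys by blast
      then show "s0 k (Poly_Mapping.lookup c k)
          + s1 k (y1 * Poly_Mapping.lookup c k) + s2 k (y2 * Poly_Mapping.lookup c k) = 0"
        using right[OF _ c_coeff] by (cases k) (simp add: multi_indices_def)
    qed
    finally show ?thesis .
  qed
  moreover have "weighted_sum s0 Q0 + weighted_sum s1 Q1 + weighted_sum s2 Q2
    = (weighted_sum s0 d + weighted_sum s1 (mX1 * d) + weighted_sum s2 (mX2 * d))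
      + (weighted_sum s0 c + weighted_sum s1 (mC y1 * c) + weighted_sum s2 (mC y2 * c))"
    unfolding Q by (simp only: weighted_sum_add s add_ac)
  ultimately show ?thesis
    by (simp only: add_0)
qed

section \<open>Bezout matrices as polynomials\<close>

lemma finite_multi_indices [simp]: "finite (multi_indices n)"
  by (rule finite_subset[of _ "{..<n} \<times> {..<n}"]) (auto simp: multi_indices_def)

definition matrix_row_poly :: "nat \<Rightarrow> mi_matrix \<Rightarrow> nat \<times> nat \<Rightarrow> complex poly2" where
  "matrix_row_poly n b i = (\<Sum>j\<in>multi_indices n. Poly_Mapping.single j (b i j))"

text \<open>
  The polynomial \<open>\<Sum> b i j x\<^sup>i y\<^sup>j\<close>, as a polynomial in \<open>x\<close> whose coefficients are polynomials in \<open>y\<close>.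
\<close>

definition matrix_poly :: "nat \<Rightarrow> mi_matrix \<Rightarrow> complex poly2 poly2" where
  "matrix_poly n b = (\<Sum>i\<in>multi_indices n. Poly_Mapping.single i (matrix_row_poly n b i))"

definition complex_poly :: "real poly2 \<Rightarrow> complex poly2" where
  "complex_poly p = (\<Sum>k\<in>Poly_Mapping.keys p. Poly_Mapping.single k (complex_of_real (Poly_Mapping.lookup p k)))"

text \<open>
  The polynomial \<open>p(x)\<close> among the polynomials in \<open>x\<close> and \<open>y\<close>; \<open>p(y)\<close> is \<open>mC (complex_poly p)\<close>.
\<close>

definition left_poly :: "real poly2 \<Rightarrow> complex poly2 poly2" where
  "left_poly p = (\<Sum>k\<in>Poly_Mapping.keys p. Poly_Mapping.single k (mC (complex_of_real (Poly_Mapping.lookup p k))))"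

abbreviation mY1 :: "complex poly2 poly2" where "mY1 \<equiv> mC mX1"
abbreviation mY2 :: "complex poly2 poly2" where "mY2 \<equiv> mC mX2"

lemma eval3_homogenize:
  "eval3 (homogenize n p) x0 x1 x2 = (\<Sum>k\<in>Poly_Mapping.keys p.
    complex_of_real (Poly_Mapping.lookup p k) * (x0 ^ (n - (fst k + snd k)) * (x1 ^ fst k * x2 ^ snd k)))"
proof -
  let ?s = "\<lambda>(a, b, c) v. v * (x0 ^ a * (x1 ^ b * x2 ^ c))"
  have fam: "additive_family ?s"
    by (auto simp: additive_family_def distrib_right)
  have "eval3 (homogenize n p) x0 x1 x2 = weighted_sum ?s (homogenize n p)"
    by (simp add: eval3_def weighted_sum_def case_prod_beta mult_ac)
  also have "\<dots> = (\<Sum>k\<in>Poly_Mapping.keys p. complex_of_real (Poly_Mapping.lookup p k)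
      * (x0 ^ (n - (fst k + snd k)) * (x1 ^ fst k * x2 ^ snd k)))"
    by (simp add: homogenize_def weighted_sum_sum[OF fam] weighted_sum_single[OF fam] case_prod_beta)
  finally show ?thesis .
qed

lemma eval3_homogenize_cnj:
  "eval3 (homogenize n p) (cnj x0) (cnj x1) (cnj x2) = cnj (eval3 (homogenize n p) x0 x1 x2)"
  by (simp add: eval3_homogenize)

text \<open>
  The polynomials have real coefficients, so the identity may be conjugated.
\<close>

lemma is_bezout_cnj:
  assumes "is_bezout n (homogenize n p) (homogenize n q) (b10, b20, b12)"
  shows "is_bezout n (homogenize n p) (homogenize n q)
    (\<lambda>i j. cnj (b10 i j), \<lambda>i j. cnj (b20 i j), \<lambda>i j. cnj (b12 i j))"
  unfolding is_bezout.simps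
proof (intro conjI allI)
  have sym: "sym_mi_matrix n b10" "sym_mi_matrix n b20" "sym_mi_matrix n b12"
    and id: "\<And>x0 x1 x2 y0 y1 y2.
      eval3 (homogenize n p) x0 x1 x2 * eval3 (homogenize n q) y0 y1 y2
        - eval3 (homogenize n q) x0 x1 x2 * eval3 (homogenize n p) y0 y1 y2 =
      (\<Sum>i\<in>multi_indices n. \<Sum>j\<in>multi_indices n.
         b10 i j * multi_power n i x0 x1 x2 * (x1 * y0 - x0 * y1) * multi_power n j y0 y1 y2
       + b20 i j * multi_power n i x0 x1 x2 * (x2 * y0 - x0 * y2) * multi_power n j y0 y1 y2
       + b12 i j * multi_power n i x0 x1 x2 * (x1 * y2 - x2 * y1) * multi_power n j y0 y1 y2)"
    using assms unfolding is_bezout.simps by blast+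
  show "sym_mi_matrix n (\<lambda>i j. cnj (b10 i j))" "sym_mi_matrix n (\<lambda>i j. cnj (b20 i j))"
    "sym_mi_matrix n (\<lambda>i j. cnj (b12 i j))"
    using sym by (simp_all add: sym_mi_matrix_def)
  fix x0 x1 x2 y0 y1 y2
  have mp: "cnj (multi_power n i (cnj x) (cnj y) (cnj z)) = multi_power n i x y z" for i x y z
    by (simp add: multi_power_def)
  show "eval3 (homogenize n p) x0 x1 x2 * eval3 (homogenize n q) y0 y1 y2
        - eval3 (homogenize n q) x0 x1 x2 * eval3 (homogenize n p) y0 y1 y2 =
      (\<Sum>i\<in>multi_indices n. \<Sum>j\<in>multi_indices n.
         cnj (b10 i j) * multi_power n i x0 x1 x2 * (x1 * y0 - x0 * y1) * multi_power n j y0 y1 y2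
       + cnj (b20 i j) * multi_power n i x0 x1 x2 * (x2 * y0 - x0 * y2) * multi_power n j y0 y1 y2
       + cnj (b12 i j) * multi_power n i x0 x1 x2 * (x1 * y2 - x2 * y1) * multi_power n j y0 y1 y2)"
    using arg_cong[OF id[of "cnj x0" "cnj x1" "cnj x2" "cnj y0" "cnj y1" "cnj y2"], of cnj]
    by (simp add: eval3_homogenize_cnj mp)
qed

lemma eval4_left_poly: "eval4 x1 x2 y1 y2 (left_poly p) = eval3 (homogenize n p) 1 x1 x2"
  by (simp add: left_poly_def eval3_homogenize[of n] eval4_simps eval_poly_single)

lemma eval4_complex_poly: "eval4 x1 x2 y1 y2 (mC (complex_poly p)) = eval3 (homogenize n p) 1 y1 y2"
  by (simp add: complex_poly_def eval3_homogenize[of n] eval4_simps eval_poly_sum eval_poly_single)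

lemma eval4_matrix_poly:
  "eval4 x1 x2 y1 y2 (matrix_poly n b)
    = (\<Sum>i\<in>multi_indices n. \<Sum>j\<in>multi_indices n. b i j * multi_power n i 1 x1 x2 * multi_power n j 1 y1 y2)"
  by (simp add: matrix_poly_def matrix_row_poly_def eval4_simps eval_poly_sum eval_poly_single
      multi_power_def sum_distrib_left sum_distrib_right mult_ac)

text \<open>
  The Bezout identity of values at \<open>x\<^sub>0 = y\<^sub>0 = 1\<close> is an identity of polynomials, because a
  polynomial function on \<open>\<complex>\<^sup>4\<close> determines its coefficients. Only in this form can operators be
  substituted.
\<close>

lemma bezout_polynomial_identity:
  assumes "is_bezout n (homogenize n p) (homogenize n q) (b10, b20, b12)"
  shows "matrix_poly n b10 * (mX1 - mY1) + matrix_poly n b20 * (mX2 - mY2)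
      + matrix_poly n b12 * (mX1 * mY2 - mX2 * mY1)
    = left_poly p * mC (complex_poly q) - left_poly q * mC (complex_poly p)" (is "?L = ?R")
proof -
  have "eval4 x1 x2 y1 y2 (?L - ?R) = 0" for x1 x2 y1 y2
  proof -
    have "eval4 x1 x2 y1 y2 ?R = (\<Sum>i\<in>multi_indices n. \<Sum>j\<in>multi_indices n.
           b10 i j * multi_power n i 1 x1 x2 * (x1 * 1 - 1 * y1) * multi_power n j 1 y1 y2
         + b20 i j * multi_power n i 1 x1 x2 * (x2 * 1 - 1 * y2) * multi_power n j 1 y1 y2
         + b12 i j * multi_power n i 1 x1 x2 * (x1 * y2 - x2 * y1) * multi_power n j 1 y1 y2)"
      unfolding eval4_simps(2,3) eval4_left_poly[of _ _ _ _ _ n] eval4_complex_poly[of _ _ _ _ _ n]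
      using assms unfolding is_bezout.simps by blast
    also have "\<dots> = eval4 x1 x2 y1 y2 ?L"
      by (simp add: eval4_simps eval4_matrix_poly eval_poly_single sum_distrib_left sum_distrib_right sum.distrib mult_ac)
    finally show ?thesis
      by (simp add: eval4_simps)
  qed
  then have "?L - ?R = 0"
    by (rule eval4_eq_0_imp_0)
  then show ?thesis
    by simp
qed

lemma lookup_matrix_poly:
  "Poly_Mapping.lookup (matrix_poly n b) i = (if i \<in> multi_indices n then matrix_row_poly n b i else 0)"
  by (simp add: matrix_poly_def lookup_sum lookup_single when_def sum.delta cong: if_cong)

lemma keys_matrix_poly: "Poly_Mapping.keys (matrix_poly n b) \<subseteq> multi_indices n"
  by (auto simp: in_keys_iff lookup_matrix_poly split: if_splits)

lemma keys_matrix_row_poly: "Poly_Mapping.keys (matrix_row_poly n b i) \<subseteq> multi_indices n"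
  by (auto simp: in_keys_iff matrix_row_poly_def lookup_sum lookup_single when_def split: if_splits cong: if_cong)

lemma weighted_sum_matrix_poly:
  assumes "additive_family s"
  shows "weighted_sum s (matrix_poly n b) = (\<Sum>i\<in>multi_indices n. s i (matrix_row_poly n b i))"
  by (simp add: matrix_poly_def weighted_sum_sum[OF assms] weighted_sum_single[OF assms])

lemma weighted_sum_const_mult_matrix_poly:
  assumes "additive_family s"
  shows "weighted_sum s (mC r * matrix_poly n b) = (\<Sum>i\<in>multi_indices n. s i (r * matrix_row_poly n b i))"
proof -
  have "additive_family (\<lambda>i a. s i (r * a))"
    using assms by (simp add: additive_family_def distrib_left)
  from weighted_sum_matrix_poly[OF this] show ?thesis
    by (simp add: weighted_sum_mult_single[OF assms])
qed

lemma keys_const_mult_matrix_poly: "Poly_Mapping.keys (mC r * matrix_poly n b) \<subseteq> multi_indices n"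
  by (auto simp: in_keys_iff lookup_const_mult lookup_matrix_poly split: if_splits)

section \<open>Polynomials in commuting operators\<close>

definition poly_action ::
  "('h::complex_vector \<Rightarrow> 'h) \<Rightarrow> ('h \<Rightarrow> 'h) \<Rightarrow> complex poly2 \<Rightarrow> 'h \<Rightarrow> 'h" where
  "poly_action T1 T2 r h = weighted_sum (\<lambda>k c. c *\<^sub>C (T1 ^^ fst k) ((T2 ^^ snd k) h)) r"

lemma additive_family_poly_action:
  "additive_family (\<lambda>k c. c *\<^sub>C (T1 ^^ fst k) ((T2 ^^ snd k) h))"
  by (simp add: additive_family_def scaleC_add_left)

lemmas weighted_sum_poly_action =
  weighted_sum_add[OF additive_family_poly_action] weighted_sum_sum[OF additive_family_poly_action]
  weighted_sum_single[OF additive_family_poly_action]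

lemma poly_action_add: "poly_action T1 T2 (r + s) h = poly_action T1 T2 r h + poly_action T1 T2 s h"
  and poly_action_sum: "poly_action T1 T2 (sum f S) h = (\<Sum>a\<in>S. poly_action T1 T2 (f a) h)"
  and poly_action_single:
    "poly_action T1 T2 (Poly_Mapping.single k c) h = c *\<^sub>C (T1 ^^ fst k) ((T2 ^^ snd k) h)"
  unfolding poly_action_def by (rule weighted_sum_poly_action)+

lemma op_poly_eq_poly_action: "op_poly p T1 T2 = poly_action T1 T2 (complex_poly p)"
  by (rule ext) (simp add: op_poly_def complex_poly_def poly_action_sum poly_action_single case_prod_beta)

lemma bounded_op_ident: "bounded_op UNIV UNIV (\<lambda>x. x)"
  by (rule bounded_opI[where K = 1]) simp_all

lemma bounded_op_funpow:
  fixes T :: "'a::complex_inner \<Rightarrow> 'a"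
  shows "bounded_op UNIV UNIV T \<Longrightarrow> bounded_op UNIV UNIV (T ^^ a)"
proof (induction a)
  case 0
  show ?case
    unfolding funpow.simps id_def by (rule bounded_op_ident)
next
  case (Suc a)
  then show ?case
    unfolding funpow.simps comp_def by (intro bounded_op_comp[of UNIV UNIV "T ^^ a" UNIV T]) simp_all
qed

lemma bounded_op_sum_apply:
  assumes "bounded_op X Y T" "complex_vector.subspace X" "\<And>i. i \<in> A \<Longrightarrow> f i \<in> X"
  shows "T (sum f A) = (\<Sum>i\<in>A. T (f i))"
proof -
  have zero: "T 0 = 0"
    using bounded_opD(3)[OF assms(1) complex_vector.subspace_0[OF assms(2)], of 0] by simp
  show ?thesis
    using assms(3)
  proof (induction A rule: infinite_finite_induct)
    case (insert a A)
    then have "T (f a + sum f A) = T (f a) + T (sum f A)"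
      by (intro bounded_opD(2)[OF assms(1)] complex_vector.subspace_sum[OF assms(2)]) simp_all
    then show ?case
      using insert by simp
  qed (simp_all add: zero)
qed

locale commuting_operators =
  fixes T1 T2 :: "'h::complex_hilbert \<Rightarrow> 'h"
  assumes bounded_T1: "bounded_op UNIV UNIV T1" and bounded_T2: "bounded_op UNIV UNIV T2"
    and T_commute: "T1 (T2 x) = T2 (T1 x)"
begin

abbreviation (input) act where "act \<equiv> poly_action T1 T2"

lemma funpow_commute_single: "(T1 ^^ a) (T2 x) = T2 ((T1 ^^ a) x)"
  by (induction a) (simp_all add: T_commute)

lemma funpow_commute: "(T1 ^^ a) ((T2 ^^ b) x) = (T2 ^^ b) ((T1 ^^ a) x)"
  by (induction b) (simp_all add: funpow_commute_single)

lemma bounded_monomial: "bounded_op UNIV UNIV (\<lambda>x. (T1 ^^ a) ((T2 ^^ b) x))"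
  by (rule bounded_op_comp[of UNIV UNIV "T2 ^^ b" UNIV "T1 ^^ a"])
    (rule bounded_op_funpow bounded_T1 bounded_T2)+

lemma bounded_act: "bounded_op UNIV UNIV (act r)"
  unfolding poly_action_def weighted_sum_def
  by (rule bounded_op_sum bounded_op_scaleC bounded_monomial complex_vector.subspace_UNIV)+

lemma act_mult: "act (r * s) h = act r (act s h)"
proof -
  have "act (r * s) h = (\<Sum>i\<in>Poly_Mapping.keys r. \<Sum>j\<in>Poly_Mapping.keys s.
      (Poly_Mapping.lookup r i * Poly_Mapping.lookup s j) *\<^sub>C
        (T1 ^^ (fst i + fst j)) ((T2 ^^ (snd i + snd j)) h))"
    unfolding poly_action_def weighted_sum_mult[OF additive_family_poly_action]
    by (simp add: weighted_sum_def)
  also have "\<dots> = (\<Sum>i\<in>Poly_Mapping.keys r. Poly_Mapping.lookup r i *\<^sub>C (T1 ^^ fst i) ((T2 ^^ snd i) (act s h)))"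
  proof (rule sum.cong[OF refl])
    fix i
    note M = bounded_monomial[of "fst i" "snd i"]
    have "(T1 ^^ fst i) ((T2 ^^ snd i) (act s h))
      = (\<Sum>j\<in>Poly_Mapping.keys s. (T1 ^^ fst i) ((T2 ^^ snd i)
          (Poly_Mapping.lookup s j *\<^sub>C (T1 ^^ fst j) ((T2 ^^ snd j) h))))"
      unfolding poly_action_def weighted_sum_def
      by (rule bounded_op_sum_apply[OF M complex_vector.subspace_UNIV]) simp
    also have "\<dots> = (\<Sum>j\<in>Poly_Mapping.keys s. Poly_Mapping.lookup s j *\<^sub>C
        (T1 ^^ (fst i + fst j)) ((T2 ^^ (snd i + snd j)) h))"
      by (rule sum.cong[OF refl])
        (simp add: bounded_opD(3)[OF M] funpow_add funpow_commute[symmetric])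
    finally show "(\<Sum>j\<in>Poly_Mapping.keys s. (Poly_Mapping.lookup r i * Poly_Mapping.lookup s j) *\<^sub>C
        (T1 ^^ (fst i + fst j)) ((T2 ^^ (snd i + snd j)) h))
      = Poly_Mapping.lookup r i *\<^sub>C (T1 ^^ fst i) ((T2 ^^ snd i) (act s h))"
      by (simp add: complex_vector.scale_sum_right)
  qed
  finally show ?thesis
    by (simp add: poly_action_def[of _ _ r] weighted_sum_def)
qed

lemma act_commute: "act r (act s h) = act s (act r h)"
  by (simp only: act_mult[symmetric] mult.commute)

lemma act_X1: "act mX1 h = T1 h" and act_X2: "act mX2 h = T2 h"
  by (simp_all add: poly_action_single)

lemma act_inverse_commute:
  assumes "bij (act q)"
  shows "inv (act q) (act r h) = act r (inv (act q) h)"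
proof -
  have "act q (act r (inv (act q) h)) = act r h"
    by (simp add: act_commute[of q] bij_is_surj[OF assms] surj_f_inv_f)
  then show ?thesis
    using inv_f_f[OF bij_is_inj[OF assms]] by metis
qed

lemma commuting_operators_cadjoint: "commuting_operators (cadjoint T1) (cadjoint T2)"
proof
  show "bounded_op UNIV UNIV (cadjoint T1)" "bounded_op UNIV UNIV (cadjoint T2)"
    by (rule bounded_op_cadjoint bounded_T1 bounded_T2)+
  fix y
  show "cadjoint T1 (cadjoint T2 y) = cadjoint T2 (cadjoint T1 y)"
    by (rule cinner_extensional)
      (simp add: cinner_cadjoint[OF bounded_T1, symmetric] cinner_cadjoint[OF bounded_T2, symmetric] T_commute)
qed

lemma cinner_funpow_cadjoint:
  fixes T :: "'h \<Rightarrow> 'h"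
  shows "bounded_op UNIV UNIV T \<Longrightarrow> cinner ((T ^^ a) x) y = cinner (x::'h) ((cadjoint T ^^ a) y)"
proof (induction a arbitrary: x)
  case (Suc a)
  then show ?case
    by (simp add: cinner_cadjoint[OF Suc.prems] funpow_swap1)
qed simp

lemma cinner_op_poly_cadjoint:
  "cinner (op_poly p T1 T2 x) y = cinner x (op_poly p (cadjoint T1) (cadjoint T2) y)"
proof -
  interpret adj: commuting_operators "cadjoint T1" "cadjoint T2"
    by (rule commuting_operators_cadjoint)
  show ?thesis
    by (simp add: op_poly_def cinner_sum_left cinner_sum_right case_prod_beta cinner_scaleC_left
        cinner_scaleC_right cinner_funpow_cadjoint bounded_T1 bounded_T2 adj.funpow_commute)
qed

end

section \<open>Completing a vessel by its output operator\<close>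

lemma comp_cadjoint_selfadjoint:
  fixes \<Phi> :: "'h::complex_hilbert \<Rightarrow> 'e::complex_inner"
  assumes \<Phi>: "bounded_op UNIV E \<Phi>"
  shows "cinner (\<Phi> (cadjoint \<Phi> u)) v = cinner u (\<Phi> (cadjoint \<Phi> v))"
  by (simp only: cinner_cadjoint[OF \<Phi>] cinner_cadjoint_left[OF \<Phi>, symmetric])

text \<open>
  The linkage condition expresses the output operator through \<open>\<Phi> \<Phi>\<^sup>* \<sigma>\<^sub>k\<close>. Applied to \<open>\<Phi> h\<close>, the
  colligation conditions turn these into \<open>\<Phi> (A\<^sub>k - A\<^sub>k\<^sup>*) h\<close>, and the adjoint terms cancel against the
  input condition.
\<close>

lemma commutative_vessel_transformed_gamma_out:
  fixes A1 A2 :: "'h::complex_hilbert \<Rightarrow> 'h" and \<Phi> :: "'h \<Rightarrow> 'e::complex_inner"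
  assumes A: "bounded_op UNIV UNIV A1" "bounded_op UNIV UNIV A2" "A1 \<circ> A2 = A2 \<circ> A1"
    and E: "fin_dim_subspace E" and \<Phi>: "bounded_op UNIV E \<Phi>"
    and sa: "selfadjoint_on E \<sigma>1" "selfadjoint_on E \<sigma>2" "selfadjoint_on E \<gamma>in"
    and colligation1: "\<And>h. cadjoint \<Phi> (\<sigma>1 (\<Phi> h)) = (1 / \<i>) *\<^sub>C (A1 h - cadjoint A1 h)"
    and colligation2: "\<And>h. cadjoint \<Phi> (\<sigma>2 (\<Phi> h)) = (1 / \<i>) *\<^sub>C (A2 h - cadjoint A2 h)"
    and input: "\<And>h. \<gamma>in (\<Phi> h) = \<sigma>1 (\<Phi> (cadjoint A2 h)) - \<sigma>2 (\<Phi> (cadjoint A1 h))"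
  shows "commutative_vessel A1 A2 \<Phi> E \<sigma>1 \<sigma>2 \<gamma>in (transformed_gamma_out \<Phi> \<sigma>1 \<sigma>2 \<gamma>in)"
proof -
  note sub = fin_dim_subspaceD[OF E]
  have b: "bounded_op E E \<sigma>1" "bounded_op E E \<sigma>2" "bounded_op E E \<gamma>in"
    using sa by (simp_all add: selfadjoint_on_def)
  define T where "T u = \<Phi> (cadjoint \<Phi> u)" for u
  have T: "bounded_op E E T"
    unfolding T_def[abs_def] by (rule bounded_op_comp[OF bounded_op_cadjoint[OF \<Phi>] \<Phi>])
  have T_sa: "cinner (T u) v = cinner u (T v)" for u v
    unfolding T_def by (rule comp_cadjoint_selfadjoint[OF \<Phi>])
  note inE = bounded_opD(1)[OF b(1)] bounded_opD(1)[OF b(2)] bounded_opD(1)[OF b(3)] bounded_opD(1)[OF T]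
  have \<sigma>1: "cinner (\<sigma>1 u) v = cinner u (\<sigma>1 v)" and \<sigma>2: "cinner (\<sigma>2 u) v = cinner u (\<sigma>2 v)"
    and \<gamma>: "cinner (\<gamma>in u) v = cinner u (\<gamma>in v)" if "u \<in> E" "v \<in> E" for u v
    using sa that by (simp_all add: selfadjoint_on_def)
  have out: "transformed_gamma_out \<Phi> \<sigma>1 \<sigma>2 \<gamma>in
      = (\<lambda>v. \<gamma>in v + \<i> *\<^sub>C (\<sigma>1 (T (\<sigma>2 v)) + (- 1) *\<^sub>C \<sigma>2 (T (\<sigma>1 v))))"
    by (simp add: transformed_gamma_out_def T_def fun_eq_iff)
  have bounded_out: "bounded_op E E (transformed_gamma_out \<Phi> \<sigma>1 \<sigma>2 \<gamma>in)"
    unfolding out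
    by (intro bounded_op_add bounded_op_scaleC b sub bounded_op_comp[OF bounded_op_comp[OF b(2) T] b(1)]
        bounded_op_comp[OF bounded_op_comp[OF b(1) T] b(2)])
  have "cinner (transformed_gamma_out \<Phi> \<sigma>1 \<sigma>2 \<gamma>in u) v
      = cinner u (transformed_gamma_out \<Phi> \<sigma>1 \<sigma>2 \<gamma>in v)" if uv: "u \<in> E" "v \<in> E" for u v
  proof -
    have "cinner (\<sigma>1 (T (\<sigma>2 u))) v = cinner u (\<sigma>2 (T (\<sigma>1 v)))"
      "cinner (\<sigma>2 (T (\<sigma>1 u))) v = cinner u (\<sigma>1 (T (\<sigma>2 v)))"
      by (simp_all add: \<sigma>1 \<sigma>2 T_sa inE uv)
    then show ?thesis
      unfolding out by (simp add: cinner_simps \<gamma>[OF uv] algebra_simps)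
  qed
  then have sa_out: "selfadjoint_on E (transformed_gamma_out \<Phi> \<sigma>1 \<sigma>2 \<gamma>in)"
    using bounded_out by (simp add: selfadjoint_on_def)
  have \<Phi>E: "\<Phi> h \<in> E" for h
    using bounded_opD(1)[OF \<Phi>] by simp
  have \<Phi>_diff: "\<Phi> ((1 / \<i>) *\<^sub>C (x - y)) = (1 / \<i>) *\<^sub>C (\<Phi> x + (- 1) *\<^sub>C \<Phi> y)" for x y
    using bounded_opD(2)[OF \<Phi>, of x "- y"] bounded_opD(3)[OF \<Phi>, of y "- 1"]
      bounded_opD(3)[OF \<Phi>, of "x - y" "1 / \<i>"] by simp
  have lin: "\<sigma> ((1 / \<i>) *\<^sub>C (u + (- 1) *\<^sub>C v)) = (1 / \<i>) *\<^sub>C (\<sigma> u - \<sigma> v)"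
    if "bounded_op E E \<sigma>" "u \<in> E" "v \<in> E" for \<sigma> u v
    using that complex_vector.subspace_scale[OF sub] complex_vector.subspace_add[OF sub]
    by (simp only: bounded_opD(2,3)[OF that(1)]) simp
  have "transformed_gamma_out \<Phi> \<sigma>1 \<sigma>2 \<gamma>in (\<Phi> h) = \<sigma>1 (\<Phi> (A2 h)) - \<sigma>2 (\<Phi> (A1 h))" for h
  proof -
    have cancel: "\<i> *\<^sub>C ((1 / \<i>) *\<^sub>C u + (- 1) *\<^sub>C (1 / \<i>) *\<^sub>C v) = u - v" for u v :: 'e
      by (simp add: complex_vector.scale_right_diff_distrib)
    have eqs: "\<sigma>1 (T (\<sigma>2 (\<Phi> h))) = (1 / \<i>) *\<^sub>C (\<sigma>1 (\<Phi> (A2 h)) - \<sigma>1 (\<Phi> (cadjoint A2 h)))"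
      "\<sigma>2 (T (\<sigma>1 (\<Phi> h))) = (1 / \<i>) *\<^sub>C (\<sigma>2 (\<Phi> (A1 h)) - \<sigma>2 (\<Phi> (cadjoint A1 h)))"
      unfolding T_def colligation1 colligation2 \<Phi>_diff by (simp_all only: lin b \<Phi>E)
    show ?thesis
      unfolding out eqs cancel input by simp
  qed
  then show ?thesis
    by unfold_locales
      (use A E \<Phi> sa sa_out colligation1 colligation2 input in \<open>simp_all add: transformed_gamma_out_def\<close>)
qed

section \<open>Vectors indexed by multi-indices\<close>

lemma lookup_scaleC:
  "Poly_Mapping.lookup (c *\<^sub>C (w :: 'i \<Rightarrow>\<^sub>0 'e::complex_inner)) i = c *\<^sub>C Poly_Mapping.lookup w i"
  by (simp add: scaleC_poly_mapping_def Poly_Mapping.map.rep_eq when_def)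

lemma single_scaleC:
  "Poly_Mapping.single i (c *\<^sub>C v :: 'e::complex_inner) = c *\<^sub>C Poly_Mapping.single i v"
  by (rule poly_mapping_eqI) (simp add: lookup_scaleC lookup_single when_def)

lemma cinner_superset:
  fixes v w :: "'i \<Rightarrow>\<^sub>0 'e::complex_inner"
  assumes "finite S" "Poly_Mapping.keys v \<subseteq> S"
  shows "cinner v w = (\<Sum>i\<in>S. cinner (Poly_Mapping.lookup v i) (Poly_Mapping.lookup w i))"
  unfolding cinner_poly_mapping_def using assms
  by (intro sum.mono_neutral_left) (auto simp: in_keys_iff)

lemma cnorm_lookup_le: "cnorm (Poly_Mapping.lookup w i) \<le> cnorm (w :: 'i \<Rightarrow>\<^sub>0 'e::complex_inner)"
proof (cases "i \<in> Poly_Mapping.keys w")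
  case True
  have "(cnorm (Poly_Mapping.lookup w i))\<^sup>2 \<le> (\<Sum>j\<in>Poly_Mapping.keys w. (cnorm (Poly_Mapping.lookup w j))\<^sup>2)"
    by (rule member_le_sum[OF True]) simp_all
  also have "\<dots> = (cnorm w)\<^sup>2"
    by (simp add: cnorm_square cinner_poly_mapping_def)
  finally show ?thesis
    by (rule power2_le_imp_le) simp
qed (simp add: in_keys_iff)

lemma bounded_op_lookup:
  assumes "\<And>w. w \<in> X \<Longrightarrow> Poly_Mapping.lookup w i \<in> Y"
  shows "bounded_op X Y (\<lambda>w. Poly_Mapping.lookup (w :: 'i \<Rightarrow>\<^sub>0 'e::complex_inner) i)"
  by (rule bounded_opI[where K = 1]) (simp_all add: assms lookup_add lookup_scaleC cnorm_lookup_le)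

lemma bounded_op_single: "bounded_op X UNIV (Poly_Mapping.single i :: 'e::complex_inner \<Rightarrow> 'i \<Rightarrow>\<^sub>0 'e)"
proof (rule bounded_opI[where K = 1])
  fix x :: 'e
  have "(cnorm (Poly_Mapping.single i x))\<^sup>2 = (cnorm x)\<^sup>2"
    by (simp add: cnorm_square cinner_superset[of "{i}"])
  then show "cnorm (Poly_Mapping.single i x) \<le> 1 * cnorm x"
    by (simp add: power2_eq_iff_nonneg)
qed (simp_all add: single_add single_scaleC)

lemma fin_dim_W_span:
  assumes "finite B"
  shows "W_space n (complex_vector.span B)
    \<subseteq> complex_vector.span (\<Union>i\<in>multi_indices n. Poly_Mapping.single i ` B)" (is "_ \<subseteq> ?S")
proof
  fix w assume w: "w \<in> W_space n (complex_vector.span B)"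
  have single: "Poly_Mapping.single i v \<in> ?S" if "i \<in> multi_indices n" "v \<in> complex_vector.span B" for i v
    using that(2)
  proof (induction rule: complex_vector.span_induct_alt)
    case base
    then show ?case by (simp add: complex_vector.span_zero)
  next
    case (step c x y)
    then have "Poly_Mapping.single i x \<in> ?S"
      using that(1) by (intro complex_vector.span_base) blast
    with step show ?case
      by (simp add: single_add single_scaleC complex_vector.span_add complex_vector.span_scale)
  qed
  have "(\<Sum>i\<in>Poly_Mapping.keys w. Poly_Mapping.single i (Poly_Mapping.lookup w i)) \<in> ?S"
    using w by (intro complex_vector.span_sum single) (auto simp: W_space_def)
  then show "w \<in> ?S"
    by (simp add: poly_mapping_sum_single)
qed

section \<open>The principal subspace of a vessel\<close>

lemma bounded_op_linear_combination:
  assumes \<sigma>: "bounded_op E Y \<sigma>" and E: "complex_vector.subspace E" and f: "\<And>j. f j \<in> E"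
  shows "(\<Sum>j\<in>S. c j *\<^sub>C \<sigma> (f j)) = \<sigma> (\<Sum>j\<in>S. c j *\<^sub>C f j)"
  using f complex_vector.subspace_scale[OF E]
  by (simp add: bounded_op_sum_apply[OF \<sigma> E] bounded_opD(3)[OF \<sigma>])

context commutative_vessel
begin

abbreviation "V n \<equiv> principal_subspace n E \<sigma>1 \<sigma>2 \<gamma>in"

abbreviation "B1 \<equiv> cadjoint A1"

abbreviation "B2 \<equiv> cadjoint A2"

lemma commuting_operators_A: "commuting_operators A1 A2"
  using bounded_A1 bounded_A2 commute by unfold_locales (simp_all add: fun_eq_iff)

lemma commuting_operators_B: "commuting_operators B1 B2"
  by (rule commuting_operators.commuting_operators_cadjoint[OF commuting_operators_A])

lemma subspace_E: "complex_vector.subspace E"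
  by (rule fin_dim_subspaceD[OF fin_dim_E])

lemma zero_in_E: "0 \<in> E"
  by (rule complex_vector.subspace_0[OF subspace_E])

lemma Phi_in_E: "\<Phi> h \<in> E"
  using bounded_opD(1)[OF bounded_Phi] by simp

lemma bounded_coefficients: "bounded_op E E \<sigma>1" "bounded_op E E \<sigma>2" "bounded_op E E \<gamma>in"
  using selfadjoint_sigma1 selfadjoint_sigma2 selfadjoint_gamma_in by (simp_all add: selfadjoint_on_def)

lemma cinner_coefficients:
  assumes "x \<in> E" "y \<in> E"
  shows "cinner (\<sigma>1 x) y = cinner x (\<sigma>1 y)" "cinner (\<sigma>2 x) y = cinner x (\<sigma>2 y)"
    "cinner (\<gamma>in x) y = cinner x (\<gamma>in y)"
  using selfadjoint_sigma1 selfadjoint_sigma2 selfadjoint_gamma_in assms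
  by (simp_all add: selfadjoint_on_def)

lemma lookup_in_E:
  assumes "w \<in> V n"
  shows "Poly_Mapping.lookup w i \<in> E"
proof (cases "i \<in> multi_indices n")
  case True
  then show ?thesis
    using assms by (simp add: principal_subspace_def W_space_def)
next
  case False
  then have "Poly_Mapping.lookup w i = 0"
    using assms by (auto simp: principal_subspace_def W_space_def in_keys_iff)
  then show ?thesis
    by (simp add: zero_in_E)
qed

lemma principal_keys: "w \<in> V n \<Longrightarrow> Poly_Mapping.keys w \<subseteq> multi_indices n"
  by (simp add: principal_subspace_def W_space_def)

lemma principal_relation:
  assumes "w \<in> V n" "Suc (a + b) < n"
  shows "\<sigma>2 (Poly_Mapping.lookup w (Suc a, b)) - \<sigma>1 (Poly_Mapping.lookup w (a, Suc b))
    + \<gamma>in (Poly_Mapping.lookup w (a, b)) = 0"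
  using assms by (auto simp: principal_subspace_def)

lemma principalI:
  assumes "Poly_Mapping.keys w \<subseteq> multi_indices n" "\<And>i. Poly_Mapping.lookup w i \<in> E"
    and "\<And>a b. Suc (a + b) < n \<Longrightarrow> \<sigma>2 (Poly_Mapping.lookup w (Suc a, b))
      - \<sigma>1 (Poly_Mapping.lookup w (a, Suc b)) + \<gamma>in (Poly_Mapping.lookup w (a, b)) = 0"
  shows "w \<in> V n"
  using assms by (auto simp: principal_subspace_def W_space_def)

lemma subspace_principal: "complex_vector.subspace (V n)"
proof (rule complex_vector.subspaceI)
  note lin = bounded_opD(2,3)[OF bounded_coefficients(1)] bounded_opD(2,3)[OF bounded_coefficients(2)]
    bounded_opD(2,3)[OF bounded_coefficients(3)]
  have z: "\<sigma> 0 = 0" if "bounded_op E E \<sigma>" for \<sigma>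
    using bounded_opD(3)[OF that zero_in_E, of 0] by simp
  show "0 \<in> V n"
    by (rule principalI) (simp_all add: zero_in_E z[OF bounded_coefficients(1)]
        z[OF bounded_coefficients(2)] z[OF bounded_coefficients(3)])
  fix v w assume v: "v \<in> V n" and w: "w \<in> V n"
  note vE = lookup_in_E[OF v] and wE = lookup_in_E[OF w]
  show "v + w \<in> V n"
  proof (rule principalI)
    show "Poly_Mapping.keys (v + w) \<subseteq> multi_indices n"
      using keys_add[of v w] principal_keys[OF v] principal_keys[OF w] by blast
    show "Poly_Mapping.lookup (v + w) i \<in> E" for i
      by (simp add: lookup_add complex_vector.subspace_add[OF subspace_E] vE wE)
    show "\<sigma>2 (Poly_Mapping.lookup (v + w) (Suc a, b)) - \<sigma>1 (Poly_Mapping.lookup (v + w) (a, Suc b))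
      + \<gamma>in (Poly_Mapping.lookup (v + w) (a, b)) = 0" if "Suc (a + b) < n" for a b
      using arg_cong2[OF principal_relation[OF v that] principal_relation[OF w that], of "(+)"]
      by (simp add: lookup_add lin vE wE algebra_simps)
  qed
  fix c
  show "c *\<^sub>C v \<in> V n"
  proof (rule principalI)
    show "Poly_Mapping.keys (c *\<^sub>C v) \<subseteq> multi_indices n"
      using principal_keys[OF v] by (auto simp: in_keys_iff lookup_scaleC)
    show "Poly_Mapping.lookup (c *\<^sub>C v) i \<in> E" for i
      by (simp add: lookup_scaleC complex_vector.subspace_scale[OF subspace_E] vE)
    show "\<sigma>2 (Poly_Mapping.lookup (c *\<^sub>C v) (Suc a, b)) - \<sigma>1 (Poly_Mapping.lookup (c *\<^sub>C v) (a, Suc b))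
      + \<gamma>in (Poly_Mapping.lookup (c *\<^sub>C v) (a, b)) = 0" if "Suc (a + b) < n" for a b
      using arg_cong[OF principal_relation[OF v that], of "\<lambda>x. c *\<^sub>C x"]
      by (simp add: lookup_scaleC lin vE complex_vector.scale_right_diff_distrib scaleC_add_right)
  qed
qed

lemma fin_dim_principal: "fin_dim_subspace (V n)"
proof -
  obtain B where B: "finite B" "E = complex_vector.span B"
    using fin_dim_E unfolding fin_dim_subspace_def by blast
  let ?C = "\<Union>i\<in>multi_indices n. Poly_Mapping.single i ` B"
  have "finite ?C"
    using B(1) by simp
  then have "fin_dim_subspace (complex_vector.span ?C)"
    unfolding fin_dim_subspace_def by blast
  moreover have "V n \<subseteq> complex_vector.span ?C"
    using fin_dim_W_span[OF B(1), of n] unfolding B(2)[symmetric] principal_subspace_def by blast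
  ultimately show ?thesis
    by (rule fin_dim_subspace_subset[OF _ _ subspace_principal])
qed

section \<open>The compressed Bezout operators\<close>

abbreviation "bez n \<equiv> bezout_op n \<sigma>1 \<sigma>2 \<gamma>in"

lemma lookup_bezout_op:
  "Poly_Mapping.lookup (bez n (b10, b20, b12) w) i = (if i \<in> multi_indices n
    then (\<Sum>j\<in>multi_indices n. b12 i j *\<^sub>C \<gamma>in (Poly_Mapping.lookup w j))
      + (\<Sum>j\<in>multi_indices n. b10 i j *\<^sub>C \<sigma>1 (Poly_Mapping.lookup w j))
      + (\<Sum>j\<in>multi_indices n. b20 i j *\<^sub>C \<sigma>2 (Poly_Mapping.lookup w j)) else 0)"
  by (simp add: lookup_sum lookup_single when_def sum.delta sum.distrib cong: if_cong)

lemma keys_bezout_op: "Poly_Mapping.keys (bez n b w) \<subseteq> multi_indices n"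
  by (cases b) (auto simp: in_keys_iff lookup_bezout_op simp del: bezout_op.simps split: if_splits)

lemma cinner_bezout_op:
  "cinner (bez n (b10, b20, b12) w) v = (\<Sum>i\<in>multi_indices n. cinner
      ((\<Sum>j\<in>multi_indices n. b12 i j *\<^sub>C \<gamma>in (Poly_Mapping.lookup w j))
      + (\<Sum>j\<in>multi_indices n. b10 i j *\<^sub>C \<sigma>1 (Poly_Mapping.lookup w j))
      + (\<Sum>j\<in>multi_indices n. b20 i j *\<^sub>C \<sigma>2 (Poly_Mapping.lookup w j))) (Poly_Mapping.lookup v i))"
  unfolding cinner_superset[OF finite_multi_indices keys_bezout_op] lookup_bezout_op
  by (rule sum.cong) simp_all

lemma cinner_bezout_op_double_sum:
  "cinner (bez n (b10, b20, b12) w) v =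
    (\<Sum>i\<in>multi_indices n. \<Sum>j\<in>multi_indices n. b12 i j * cinner (\<gamma>in (Poly_Mapping.lookup w j)) (Poly_Mapping.lookup v i))
  + (\<Sum>i\<in>multi_indices n. \<Sum>j\<in>multi_indices n. b10 i j * cinner (\<sigma>1 (Poly_Mapping.lookup w j)) (Poly_Mapping.lookup v i))
  + (\<Sum>i\<in>multi_indices n. \<Sum>j\<in>multi_indices n. b20 i j * cinner (\<sigma>2 (Poly_Mapping.lookup w j)) (Poly_Mapping.lookup v i))"
  unfolding cinner_bezout_op
  by (simp only: cinner_add_left cinner_sum_left cinner_scaleC_left sum.distrib)

text \<open>
  Since the matrices are symmetric rather than Hermitian, the adjoint of a Bezout operator is the
  Bezout operator of the conjugate matrices.
\<close>

lemma cinner_bezout_op_swap: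
  assumes sym: "sym_mi_matrix n b10" "sym_mi_matrix n b20" "sym_mi_matrix n b12"
    and w: "w \<in> V n" and v: "v \<in> V n"
  shows "cinner w (bez n (b10, b20, b12) v)
    = cinner (bez n (\<lambda>i j. cnj (b10 i j), \<lambda>i j. cnj (b20 i j), \<lambda>i j. cnj (b12 i j)) w) v"
proof -
  have swap: "cnj (\<Sum>i\<in>multi_indices n. \<Sum>j\<in>multi_indices n.
        b i j * cinner (\<sigma> (Poly_Mapping.lookup v j)) (Poly_Mapping.lookup w i))
      = (\<Sum>i\<in>multi_indices n. \<Sum>j\<in>multi_indices n.
        cnj (b i j) * cinner (\<sigma> (Poly_Mapping.lookup w j)) (Poly_Mapping.lookup v i))"
    if b: "sym_mi_matrix n b" and \<sigma>: "\<And>x y. \<lbrakk>x \<in> E; y \<in> E\<rbrakk> \<Longrightarrow> cinner (\<sigma> x) y = cinner x (\<sigma> y)" for b \<sigma>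
  proof -
    have "cnj (\<Sum>i\<in>multi_indices n. \<Sum>j\<in>multi_indices n.
        b i j * cinner (\<sigma> (Poly_Mapping.lookup v j)) (Poly_Mapping.lookup w i))
      = (\<Sum>i\<in>multi_indices n. \<Sum>j\<in>multi_indices n.
        cnj (b i j) * cinner (Poly_Mapping.lookup w i) (\<sigma> (Poly_Mapping.lookup v j)))"
      by (simp flip: cinner_commute)
    also have "\<dots> = (\<Sum>j\<in>multi_indices n. \<Sum>i\<in>multi_indices n.
        cnj (b i j) * cinner (Poly_Mapping.lookup w i) (\<sigma> (Poly_Mapping.lookup v j)))"
      by (rule sum.swap)
    also have "\<dots> = (\<Sum>j\<in>multi_indices n. \<Sum>i\<in>multi_indices n.
        cnj (b j i) * cinner (\<sigma> (Poly_Mapping.lookup w i)) (Poly_Mapping.lookup v j))"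
    proof (intro sum.cong refl)
      fix i j assume "i \<in> multi_indices n" "j \<in> multi_indices n"
      then have "b i j = b j i"
        using b unfolding sym_mi_matrix_def by blast
      then show "cnj (b i j) * cinner (Poly_Mapping.lookup w i) (\<sigma> (Poly_Mapping.lookup v j))
        = cnj (b j i) * cinner (\<sigma> (Poly_Mapping.lookup w i)) (Poly_Mapping.lookup v j)"
        by (simp add: \<sigma> lookup_in_E[OF w] lookup_in_E[OF v])
    qed
    finally show ?thesis .
  qed
  have "cinner w (bez n (b10, b20, b12) v) = cnj (cinner (bez n (b10, b20, b12) v) w)"
    by (rule cinner_commute)
  also have "\<dots> = cinner (bez n (\<lambda>i j. cnj (b10 i j), \<lambda>i j. cnj (b20 i j), \<lambda>i j. cnj (b12 i j)) w) v"
    unfolding cinner_bezout_op_double_sum complex_cnj_add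
    by (simp only: swap[OF sym(1) cinner_coefficients(1)] swap[OF sym(2) cinner_coefficients(2)]
        swap[OF sym(3) cinner_coefficients(3)])
  finally show ?thesis .
qed

text \<open>
  By selfadjointness, the relation that defines the principal subspace can be read as one between
  linear functionals of \<open>x\<close>.
\<close>

lemma principal_relation_cinner:
  assumes v: "v \<in> V n" and "Suc (a + b) < n" and x: "x \<in> E"
  shows "cinner (\<gamma>in x) (Poly_Mapping.lookup v (a, b)) + cinner (\<sigma>2 x) (Poly_Mapping.lookup v (Suc a, b))
    - cinner (\<sigma>1 x) (Poly_Mapping.lookup v (a, Suc b)) = 0"
proof -
  have "cinner (\<gamma>in x) (Poly_Mapping.lookup v (a, b)) + cinner (\<sigma>2 x) (Poly_Mapping.lookup v (Suc a, b))
    - cinner (\<sigma>1 x) (Poly_Mapping.lookup v (a, Suc b))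
    = cinner x (\<sigma>2 (Poly_Mapping.lookup v (Suc a, b)) - \<sigma>1 (Poly_Mapping.lookup v (a, Suc b))
        + \<gamma>in (Poly_Mapping.lookup v (a, b)))"
    by (simp add: cinner_coefficients[OF x lookup_in_E[OF v]] cinner_simps)
  then show ?thesis
    by (simp add: principal_relation[OF assms(1,2)])
qed

text \<open>
  Two Bezout triples of the same pair of polynomials differ by a syzygy of the minors, whose pairing
  with vectors from the principal subspace vanishes. So the compression does not depend on the triple.
\<close>

lemma cinner_bezout_op_unique:
  assumes b: "is_bezout n (homogenize n p) (homogenize n q) (b10, b20, b12)"
    and c: "is_bezout n (homogenize n p) (homogenize n q) (c10, c20, c12)"
    and w: "w \<in> V n" and v: "v \<in> V n"
  shows "cinner (bez n (b10, b20, b12) w) v = cinner (bez n (c10, c20, c12) w) v"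
proof -
  define s where "s \<sigma> i = weighted_sum (\<lambda>j a. a * cinner (\<sigma> (Poly_Mapping.lookup w j)) (Poly_Mapping.lookup v i))"
    for \<sigma> i
  have inner: "additive_family (\<lambda>j a. a * cinner (\<sigma> (Poly_Mapping.lookup w j)) (Poly_Mapping.lookup v i))" for \<sigma> i
    by (simp add: additive_family_def distrib_right)
  have fam: "additive_family (s \<sigma>)" for \<sigma>
    unfolding s_def additive_family_def by (simp add: weighted_sum_add inner)
  have fam_m: "additive_family (\<lambda>i r. - s \<sigma> i r)" for \<sigma>
    using fam[of \<sigma>] by (simp add: additive_family_def)
  have s_matrix: "weighted_sum (s \<sigma>) (matrix_poly n a) = (\<Sum>i\<in>multi_indices n. \<Sum>j\<in>multi_indices n.
      a i j * cinner (\<sigma> (Poly_Mapping.lookup w j)) (Poly_Mapping.lookup v i))" for \<sigma> a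
    unfolding weighted_sum_matrix_poly[OF fam]
    by (simp add: s_def matrix_row_poly_def weighted_sum_sum[OF inner] weighted_sum_single[OF inner])
  have minus: "weighted_sum (\<lambda>i r. - s \<sigma> i r) Q = - weighted_sum (s \<sigma>) Q" for \<sigma> Q
    by (simp add: weighted_sum_def sum_negf)
  \<comment> \<open>The relations of \<open>w\<close> stop at degree \<open>n - 2\<close>, so the cofactors must be bounded in \<open>y\<close> as well.\<close>
  let ?D = "\<lambda>m. {r :: complex poly2. Poly_Mapping.keys r \<subseteq> multi_indices m}"
  define Q where "Q b c = matrix_poly n b - matrix_poly n c" for b c
  have keys_Q: "Poly_Mapping.keys (Q b c) \<subseteq> multi_indices n" for b c
    unfolding Q_def by (rule order_trans[OF keys_diff]) (simp add: keys_matrix_poly)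
  have coeff_Q: "Poly_Mapping.lookup (Q b c) k \<in> ?D n" for b c k
    using keys_diff[of "Poly_Mapping.lookup (matrix_poly n b) k" "Poly_Mapping.lookup (matrix_poly n c) k"]
      keys_matrix_row_poly[of n b k] keys_matrix_row_poly[of n c k]
    by (auto simp: Q_def lookup_minus lookup_matrix_poly split: if_splits)
  have "weighted_sum (s \<gamma>in) (Q b12 c12) + weighted_sum (s \<sigma>2) (Q b20 c20)
    + weighted_sum (\<lambda>i r. - s \<sigma>1 i r) (- Q b10 c10) = 0"
  proof (rule pairing_vanishes[where n = n and D = "?D n" and D' = "?D (n - 1)" and ?y1.0 = mX1 and ?y2.0 = mX2])
    show "Q b12 c12 * (mX1 * mY2 - mX2 * mY1) + Q b20 c20 * (mX2 - mY2) + - Q b10 c10 * (mY1 - mX1) = 0"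
    proof -
      let ?L = "\<lambda>b10 b20 b12. matrix_poly n b10 * (mX1 - mY1) + matrix_poly n b20 * (mX2 - mY2)
        + matrix_poly n b12 * (mX1 * mY2 - mX2 * mY1)"
      have "Q b12 c12 * (mX1 * mY2 - mX2 * mY1) + Q b20 c20 * (mX2 - mY2) + - Q b10 c10 * (mY1 - mX1)
        = ?L b10 b20 b12 - ?L c10 c20 c12"
        unfolding Q_def by (simp add: algebra_simps)
      then show ?thesis
        unfolding bezout_polynomial_identity[OF b] bezout_polynomial_identity[OF c] by simp
    qed
    show "r + s \<in> ?D n" "r - s \<in> ?D n" if "r \<in> ?D n" "s \<in> ?D n" for r s
      using that keys_add[of r s] keys_diff[of r s] by auto
    show "?D (n - 1) \<subseteq> ?D n"
      by (auto simp: multi_indices_def)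
    show "r \<in> ?D (n - 1)" if "mX1 * r \<in> ?D n" for r
    proof clarify
      fix a b assume "(a, b) \<in> Poly_Mapping.keys r"
      then have "(Suc a, b) \<in> Poly_Mapping.keys (mX1 * r)"
        by (simp add: in_keys_iff)
      with that show "(a, b) \<in> multi_indices (n - 1)"
        by (auto simp: multi_indices_def)
    qed
    fix a b and r :: "complex poly2"
    show "s \<gamma>in (a, b) r + s \<sigma>2 (Suc a, b) r + - s \<sigma>1 (a, Suc b) r = 0" if "Suc (a + b) < n"
    proof -
      have "s \<gamma>in (a, b) r + s \<sigma>2 (Suc a, b) r + - s \<sigma>1 (a, Suc b) r
        = (\<Sum>j\<in>Poly_Mapping.keys r. Poly_Mapping.lookup r j *
            (cinner (\<gamma>in (Poly_Mapping.lookup w j)) (Poly_Mapping.lookup v (a, b))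
            + cinner (\<sigma>2 (Poly_Mapping.lookup w j)) (Poly_Mapping.lookup v (Suc a, b))
            - cinner (\<sigma>1 (Poly_Mapping.lookup w j)) (Poly_Mapping.lookup v (a, Suc b))))"
        by (simp add: s_def weighted_sum_def sum.distrib sum_subtractf algebra_simps)
      also have "\<dots> = 0"
        by (simp add: principal_relation_cinner[OF v that lookup_in_E[OF w]])
      finally show ?thesis .
    qed
    show "s \<gamma>in (a, b) r + s \<sigma>2 (a, b) (mX1 * r) + - s \<sigma>1 (a, b) (mX2 * r) = 0" if "r \<in> ?D (n - 1)"
    proof -
      have "s \<gamma>in (a, b) r + s \<sigma>2 (a, b) (mX1 * r) + - s \<sigma>1 (a, b) (mX2 * r)
        = (\<Sum>j\<in>Poly_Mapping.keys r. Poly_Mapping.lookup r j *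
            cinner (\<sigma>2 (Poly_Mapping.lookup w ((Suc 0, 0) + j)) - \<sigma>1 (Poly_Mapping.lookup w ((0, Suc 0) + j))
              + \<gamma>in (Poly_Mapping.lookup w j)) (Poly_Mapping.lookup v (a, b)))"
        by (simp add: s_def weighted_sum_mult_single[OF inner])
          (simp add: weighted_sum_def cinner_simps sum.distrib sum_subtractf algebra_simps)
      also have "\<dots> = 0"
      proof (intro sum.neutral ballI)
        fix j assume j: "j \<in> Poly_Mapping.keys r"
        obtain j1 j2 where [simp]: "j = (j1, j2)" by force
        have "Suc (j1 + j2) < n"
          using j that by (auto simp: multi_indices_def)
        from principal_relation[OF w this]
        show "Poly_Mapping.lookup r j *
            cinner (\<sigma>2 (Poly_Mapping.lookup w ((Suc 0, 0) + j)) - \<sigma>1 (Poly_Mapping.lookup w ((0, Suc 0) + j))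
              + \<gamma>in (Poly_Mapping.lookup w j)) (Poly_Mapping.lookup v (a, b)) = 0"
          by simp
      qed
      finally show ?thesis .
    qed
  qed (rule keys_Q coeff_Q fam fam_m)+
  then show ?thesis
    unfolding cinner_bezout_op_double_sum s_matrix[symmetric]
    by (simp add: minus Q_def weighted_sum_diff fam weighted_sum_minus algebra_simps)
qed

lemma compressed_bezout_op_principal:
  "w \<in> V n \<Longrightarrow> compressed_bezout_op n E \<sigma>1 \<sigma>2 \<gamma>in b w = orth_proj (V n) (bez n b w)"
  by (simp add: compressed_bezout_op_def Let_def orth_proj_ident[OF fin_dim_principal])

lemma cinner_compressed_bezout_op:
  assumes "w \<in> V n" "v \<in> V n"
  shows "cinner (compressed_bezout_op n E \<sigma>1 \<sigma>2 \<gamma>in b w) v = cinner (bez n b w) v"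
  using assms by (simp add: compressed_bezout_op_principal cinner_orth_proj_left[OF fin_dim_principal])

lemma bounded_compressed_bezout_op: "bounded_op (V n) (V n) (compressed_bezout_op n E \<sigma>1 \<sigma>2 \<gamma>in b)"
proof -
  obtain b10 b20 b12 where b: "b = (b10, b20, b12)"
    by (cases b)
  have look: "bounded_op (V n) E (\<lambda>w. Poly_Mapping.lookup w j)" for j
    by (rule bounded_op_lookup) (rule lookup_in_E)
  note coeff = bounded_op_comp[OF look bounded_coefficients(1)] bounded_op_comp[OF look bounded_coefficients(2)]
    bounded_op_comp[OF look bounded_coefficients(3)]
  have "bounded_op (V n) E (\<lambda>w. \<Sum>j\<in>multi_indices n. b12 i j *\<^sub>C \<gamma>in (Poly_Mapping.lookup w j)
        + b10 i j *\<^sub>C \<sigma>1 (Poly_Mapping.lookup w j) + b20 i j *\<^sub>C \<sigma>2 (Poly_Mapping.lookup w j))" for i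
    by (intro bounded_op_sum bounded_op_add bounded_op_scaleC coeff subspace_E)
  then have "bounded_op (V n) UNIV (\<lambda>w. Poly_Mapping.single i (\<Sum>j\<in>multi_indices n. b12 i j *\<^sub>C \<gamma>in (Poly_Mapping.lookup w j)
        + b10 i j *\<^sub>C \<sigma>1 (Poly_Mapping.lookup w j) + b20 i j *\<^sub>C \<sigma>2 (Poly_Mapping.lookup w j)))" for i
    by (rule bounded_op_comp[OF _ bounded_op_single])
  then have B: "bounded_op (V n) UNIV (bez n b)"
    unfolding b bezout_op.simps by (intro bounded_op_sum complex_vector.subspace_UNIV)
  note P = bounded_op_orth_proj[OF fin_dim_principal, of n]
  have "bounded_op (V n) (V n) (\<lambda>w. orth_proj (V n) (bez n b (orth_proj (V n) w)))"
    by (rule bounded_op_comp[OF bounded_op_comp[OF bounded_op_mono[OF P subset_UNIV] B] P])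
  then show ?thesis
    by (simp add: compressed_bezout_op_def[abs_def] Let_def)
qed

lemma selfadjoint_compressed_bezout_op:
  assumes b: "is_bezout n (homogenize n p) (homogenize n q) b"
  shows "selfadjoint_on (V n) (compressed_bezout_op n E \<sigma>1 \<sigma>2 \<gamma>in b)"
  unfolding selfadjoint_on_def
proof (intro conjI ballI)
  show "bounded_op (V n) (V n) (compressed_bezout_op n E \<sigma>1 \<sigma>2 \<gamma>in b)"
    by (rule bounded_compressed_bezout_op)
  fix w v assume w: "w \<in> V n" and v: "v \<in> V n"
  obtain b10 b20 b12 where b_eq: "b = (b10, b20, b12)"
    by (cases b)
  note b' = b[unfolded b_eq]
  have sym: "sym_mi_matrix n b10" "sym_mi_matrix n b20" "sym_mi_matrix n b12"
    using b' unfolding is_bezout.simps by blast+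
  have "cinner (compressed_bezout_op n E \<sigma>1 \<sigma>2 \<gamma>in b w) v = cinner (bez n b w) v"
    by (rule cinner_compressed_bezout_op[OF w v])
  also have "\<dots> = cinner w (bez n b v)"
    unfolding b_eq cinner_bezout_op_swap[OF sym w v]
    by (rule cinner_bezout_op_unique[OF b' is_bezout_cnj[OF b'] w v])
  also have "\<dots> = cinner w (compressed_bezout_op n E \<sigma>1 \<sigma>2 \<gamma>in b v)"
    using v w by (simp add: compressed_bezout_op_principal cinner_orth_proj_right[OF fin_dim_principal])
  finally show "cinner (compressed_bezout_op n E \<sigma>1 \<sigma>2 \<gamma>in b w) v
    = cinner w (compressed_bezout_op n E \<sigma>1 \<sigma>2 \<gamma>in b v)" .
qed

section \<open>Moment vectors\<close>

abbreviation "act \<equiv> poly_action B1 B2"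

text \<open>
  The vector called \<open>W k\<close> in the introduction; it is \<open>\<Phi>'\<close> before the inversion of \<open>p\<^sub>0\<close>.
\<close>

definition moment_vec :: "nat \<Rightarrow> 'h \<Rightarrow> 'e mvec" where
  "moment_vec n k = (\<Sum>(i1, i2)\<in>multi_indices n. Poly_Mapping.single (i1, i2) (\<Phi> ((B1 ^^ i1) ((B2 ^^ i2) k))))"

lemma lookup_moment_vec:
  "Poly_Mapping.lookup (moment_vec n k) i
    = (if i \<in> multi_indices n then \<Phi> ((B1 ^^ fst i) ((B2 ^^ snd i) k)) else 0)"
  by (simp add: moment_vec_def case_prod_beta lookup_sum lookup_single when_def sum.delta cong: if_cong)

lemma Phi_relation: "\<sigma>2 (\<Phi> (B1 h)) - \<sigma>1 (\<Phi> (B2 h)) + \<gamma>in (\<Phi> h) = 0"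
  by (simp add: input_condition)

text \<open>
  The relations of the principal subspace are the input condition at the vectors \<open>B\<^sub>1\<^sup>a B\<^sub>2\<^sup>b k\<close>.
\<close>

lemma moment_vec_principal: "moment_vec n k \<in> V n"
proof (rule principalI)
  interpret B: commuting_operators B1 B2 by (rule commuting_operators_B)
  show "Poly_Mapping.keys (moment_vec n k) \<subseteq> multi_indices n"
    by (auto simp: in_keys_iff lookup_moment_vec split: if_splits)
  show "Poly_Mapping.lookup (moment_vec n k) i \<in> E" for i
    by (simp add: lookup_moment_vec Phi_in_E zero_in_E)
  show "\<sigma>2 (Poly_Mapping.lookup (moment_vec n k) (Suc a, b)) - \<sigma>1 (Poly_Mapping.lookup (moment_vec n k) (a, Suc b))
      + \<gamma>in (Poly_Mapping.lookup (moment_vec n k) (a, b)) = 0" if "Suc (a + b) < n" for a b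
    using that Phi_relation[of "(B1 ^^ a) ((B2 ^^ b) k)"]
    by (simp add: lookup_moment_vec multi_indices_def B.funpow_commute_single)
qed

lemma bounded_moment_vec: "bounded_op UNIV (V n) (moment_vec n)"
proof -
  interpret B: commuting_operators B1 B2 by (rule commuting_operators_B)
  have "bounded_op UNIV UNIV (moment_vec n)"
    unfolding moment_vec_def[abs_def] case_prod_beta
    by (intro bounded_op_sum complex_vector.subspace_UNIV
        bounded_op_comp[OF bounded_op_comp[OF B.bounded_monomial bounded_Phi] bounded_op_single])
  then show ?thesis
    using moment_vec_principal unfolding bounded_op_def by blast
qed

lemma matrix_row_poly_moment_vec:
  assumes \<sigma>: "bounded_op E E \<sigma>"
  shows "(\<Sum>j\<in>multi_indices n. b i j *\<^sub>C \<sigma> (Poly_Mapping.lookup (moment_vec n k) j))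
    = \<sigma> (\<Phi> (act (matrix_row_poly n b i) k))"
proof -
  have "act (matrix_row_poly n b i) k = (\<Sum>j\<in>multi_indices n. b i j *\<^sub>C (B1 ^^ fst j) ((B2 ^^ snd j) k))"
    by (simp add: matrix_row_poly_def poly_action_sum poly_action_single)
  then have "\<Phi> (act (matrix_row_poly n b i) k)
      = (\<Sum>j\<in>multi_indices n. b i j *\<^sub>C \<Phi> ((B1 ^^ fst j) ((B2 ^^ snd j) k)))"
    by (simp add: bounded_op_sum_apply[OF bounded_Phi complex_vector.subspace_UNIV] bounded_opD(3)[OF bounded_Phi])
  also have "\<dots> = (\<Sum>j\<in>multi_indices n. b i j *\<^sub>C Poly_Mapping.lookup (moment_vec n k) j)"
    by (rule sum.cong) (simp_all add: lookup_moment_vec)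
  finally show ?thesis
    using bounded_op_linear_combination[OF \<sigma> subspace_E, of "Poly_Mapping.lookup (moment_vec n k)"]
    by (simp add: lookup_in_E[OF moment_vec_principal])
qed

lemma cinner_bezout_op_moment_vec:
  "cinner (bez n (b10, b20, b12) (moment_vec n k)) v = (\<Sum>i\<in>multi_indices n.
      cinner (\<gamma>in (\<Phi> (act (matrix_row_poly n b12 i) k))) (Poly_Mapping.lookup v i)
    + cinner (\<sigma>1 (\<Phi> (act (matrix_row_poly n b10 i) k))) (Poly_Mapping.lookup v i)
    + cinner (\<sigma>2 (\<Phi> (act (matrix_row_poly n b20 i) k))) (Poly_Mapping.lookup v i))"
  unfolding cinner_bezout_op matrix_row_poly_moment_vec[OF bounded_coefficients(1)]
    matrix_row_poly_moment_vec[OF bounded_coefficients(2)] matrix_row_poly_moment_vec[OF bounded_coefficients(3)]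
  by (simp only: cinner_add_left)

section \<open>Colligation conditions\<close>

text \<open>
  Up to the factor \<open>1/\<i>\<close>, the operators \<open>\<Phi>\<^sup>*\<sigma>\<^sub>1\<Phi>\<close>, \<open>\<Phi>\<^sup>*\<sigma>\<^sub>2\<Phi>\<close>, \<open>\<Phi>\<^sup>*\<gamma>in\<Phi>\<close> are the minors
  \<open>x\<^sub>1 - y\<^sub>1\<close>, \<open>x\<^sub>2 - y\<^sub>2\<close>, \<open>x\<^sub>1y\<^sub>2 - x\<^sub>2y\<^sub>1\<close> with \<open>A\<close> in place of \<open>x\<close>, to the left of \<open>B\<close> in place of \<open>y\<close>.
\<close>

lemma cinner_coefficients_Phi:
  "cinner (\<sigma>1 (\<Phi> x)) (\<Phi> y) = (1 / \<i>) * (cinner x (B1 y) - cinner (B1 x) y)"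
  "cinner (\<sigma>2 (\<Phi> x)) (\<Phi> y) = (1 / \<i>) * (cinner x (B2 y) - cinner (B2 x) y)"
  "cinner (\<gamma>in (\<Phi> x)) (\<Phi> y) = (1 / \<i>) * (cinner (B2 x) (B1 y) - cinner (B1 x) (B2 y))"
proof -
  interpret B: commuting_operators B1 B2 by (rule commuting_operators_B)
  have 1: "cinner (\<sigma>1 (\<Phi> x)) (\<Phi> y) = (1 / \<i>) * (cinner x (B1 y) - cinner (B1 x) y)" for x y
    unfolding cinner_cadjoint_left[OF bounded_Phi, symmetric] colligation1
    by (simp only: cinner_scaleC_left cinner_diff_left cinner_cadjoint[OF bounded_A1])
  have 2: "cinner (\<sigma>2 (\<Phi> x)) (\<Phi> y) = (1 / \<i>) * (cinner x (B2 y) - cinner (B2 x) y)" for x y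
    unfolding cinner_cadjoint_left[OF bounded_Phi, symmetric] colligation2
    by (simp only: cinner_scaleC_left cinner_diff_left cinner_cadjoint[OF bounded_A2])
  show "cinner (\<sigma>1 (\<Phi> x)) (\<Phi> y) = (1 / \<i>) * (cinner x (B1 y) - cinner (B1 x) y)"
    "cinner (\<sigma>2 (\<Phi> x)) (\<Phi> y) = (1 / \<i>) * (cinner x (B2 y) - cinner (B2 x) y)"
    by (rule 1 2)+
  show "cinner (\<gamma>in (\<Phi> x)) (\<Phi> y) = (1 / \<i>) * (cinner (B2 x) (B1 y) - cinner (B1 x) (B2 y))"
    unfolding input_condition cinner_diff_left 1 2 by (simp add: B.T_commute algebra_simps)
qed

text \<open>
  The functional \<open>x\<^sup>i r(y) \<mapsto> \<langle>A\<^sup>i r(B) u, v\<rangle>\<close> is applied to both sides of the Bezout identity.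
\<close>

lemma cinner_bezout_op_moment_vecs:
  assumes b: "is_bezout n (homogenize n p) (homogenize n q) b"
  shows "cinner (bez n b (moment_vec n u)) (moment_vec n v) = (1 / \<i>) *
    (cinner (act (complex_poly q) u) (act (complex_poly p) v)
      - cinner (act (complex_poly p) u) (act (complex_poly q) v))"
proof -
  interpret B: commuting_operators B1 B2 by (rule commuting_operators_B)
  obtain b10 b20 b12 where b_eq: "b = (b10, b20, b12)"
    by (cases b)
  define m where "m i r = cinner (act r u) ((B1 ^^ fst i) ((B2 ^^ snd i) v))" for i :: "nat \<times> nat" and r
  have fam: "additive_family m"
    by (simp add: additive_family_def m_def poly_action_add cinner_add_left)
  have left: "weighted_sum m (left_poly p * mC r) = cinner (act r u) (act (complex_poly p) v)" for p r
  proof -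
    have "weighted_sum m (left_poly p * mC r) = (\<Sum>k\<in>Poly_Mapping.keys p.
        m k (mC (complex_of_real (Poly_Mapping.lookup p k)) * r))"
      unfolding left_poly_def sum_distrib_right weighted_sum_sum[OF fam]
      by (simp add: mult_single weighted_sum_single[OF fam])
    also have "\<dots> = (\<Sum>k\<in>Poly_Mapping.keys p. complex_of_real (Poly_Mapping.lookup p k) * m k r)"
      by (simp add: m_def B.act_mult poly_action_single cinner_scaleC_left)
    also have "\<dots> = cinner (act r u) (act (complex_poly p) v)"
      by (simp add: m_def complex_poly_def poly_action_sum poly_action_single cinner_sum_right cinner_scaleC_right)
    finally show ?thesis .
  qed
  let ?row = "\<lambda>b i. act (matrix_row_poly n b i) u" and ?mon = "\<lambda>i. (B1 ^^ fst i) ((B2 ^^ snd i) v)"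
  have shift: "weighted_sum m (matrix_poly n b * Poly_Mapping.single k r)
      = (\<Sum>i\<in>multi_indices n. m (k + i) (r * matrix_row_poly n b i))" for b k r
  proof -
    have "additive_family (\<lambda>i r'. m (k + i) (r * r'))"
      by (simp add: additive_family_def distrib_left additive_familyD[OF fam])
    from weighted_sum_matrix_poly[OF this] show ?thesis
      by (simp add: mult.commute[of "matrix_poly n b"] weighted_sum_mult_single[OF fam])
  qed
  have XY: "mX1 * mY2 = Poly_Mapping.single (Suc 0, 0) mX2" "mX2 * mY1 = Poly_Mapping.single (0, Suc 0) mX1"
    by (simp_all add: mult_single)
  have "(\<Sum>i\<in>multi_indices n.
        cinner (?row b10 i) (B1 (?mon i)) - cinner (B1 (?row b10 i)) (?mon i)
      + (cinner (?row b20 i) (B2 (?mon i)) - cinner (B2 (?row b20 i)) (?mon i))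
      + (cinner (B2 (?row b12 i)) (B1 (?mon i)) - cinner (B1 (?row b12 i)) (B2 (?mon i))))
    = weighted_sum m (matrix_poly n b10 * (mX1 - mY1) + matrix_poly n b20 * (mX2 - mY2)
      + matrix_poly n b12 * (mX1 * mY2 - mX2 * mY1))"
    unfolding right_diff_distrib XY weighted_sum_add[OF fam] weighted_sum_diff[OF fam] shift
    by (simp add: m_def B.act_mult B.act_X1 B.act_X2
        B.funpow_commute_single sum.distrib sum_subtractf)
  also have "\<dots> = cinner (act (complex_poly q) u) (act (complex_poly p) v)
      - cinner (act (complex_poly p) u) (act (complex_poly q) v)"
    unfolding bezout_polynomial_identity[OF b[unfolded b_eq]] weighted_sum_diff[OF fam] left ..
  finally have "(1 / \<i>) * (\<Sum>i\<in>multi_indices n.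
        cinner (?row b10 i) (B1 (?mon i)) - cinner (B1 (?row b10 i)) (?mon i)
      + (cinner (?row b20 i) (B2 (?mon i)) - cinner (B2 (?row b20 i)) (?mon i))
      + (cinner (B2 (?row b12 i)) (B1 (?mon i)) - cinner (B1 (?row b12 i)) (B2 (?mon i))))
    = (1 / \<i>) * (cinner (act (complex_poly q) u) (act (complex_poly p) v)
      - cinner (act (complex_poly p) u) (act (complex_poly q) v))"
    by (rule arg_cong)
  then have "(1 / \<i>) * (cinner (act (complex_poly q) u) (act (complex_poly p) v)
      - cinner (act (complex_poly p) u) (act (complex_poly q) v))
    = (\<Sum>i\<in>multi_indices n.
        (1 / \<i>) * (cinner (?row b10 i) (B1 (?mon i)) - cinner (B1 (?row b10 i)) (?mon i))
      + (1 / \<i>) * (cinner (?row b20 i) (B2 (?mon i)) - cinner (B2 (?row b20 i)) (?mon i))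
      + (1 / \<i>) * (cinner (B2 (?row b12 i)) (B1 (?mon i)) - cinner (B1 (?row b12 i)) (B2 (?mon i))))"
    unfolding sum_distrib_left distrib_left by (rule sym)
  also have "\<dots> = cinner (bez n (b10, b20, b12) (moment_vec n u)) (moment_vec n v)"
    unfolding cinner_bezout_op_moment_vec
    by (rule sum.cong) (simp_all add: lookup_moment_vec cinner_coefficients_Phi add_ac)
  finally show ?thesis
    unfolding b_eq by simp
qed

section \<open>The input condition\<close>

text \<open>
  In the combination \<open>p\<^sub>0(y) \<beta>(p\<^sub>1, p\<^sub>2) - p\<^sub>2(y) \<beta>(p\<^sub>1, p\<^sub>0) + p\<^sub>1(y) \<beta>(p\<^sub>2, p\<^sub>0)\<close> the right sides of the
  Bezout identities cancel, so it is a syzygy. There is no bound on the degree in \<open>y\<close> here,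
  because the relation of \<open>\<Phi> B\<^sub>1\<^sup>a B\<^sub>2\<^sup>b k\<close> holds for all \<open>a\<close> and \<open>b\<close>.
\<close>

lemma input_condition_moment_vec:
  assumes b10: "is_bezout n (homogenize n p1) (homogenize n p0) bez10"
    and b20: "is_bezout n (homogenize n p2) (homogenize n p0) bez20"
    and b12: "is_bezout n (homogenize n p1) (homogenize n p2) bez12"
    and v: "v \<in> V n"
  shows "cinner (bez n bez12 (moment_vec n (act (complex_poly p0) k))) v
    = cinner (bez n bez10 (moment_vec n (act (complex_poly p2) k))) v
      - cinner (bez n bez20 (moment_vec n (act (complex_poly p1) k))) v"
proof -
  interpret B: commuting_operators B1 B2 by (rule commuting_operators_B)
  define s where "s \<sigma> i r = cinner (\<sigma> (\<Phi> (act r k))) (Poly_Mapping.lookup v i)"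
    for \<sigma> :: "'e \<Rightarrow> 'e" and i :: "nat \<times> nat" and r
  have fam: "additive_family (s \<sigma>)" if "bounded_op E E \<sigma>" for \<sigma>
    by (simp add: additive_family_def s_def poly_action_add bounded_opD(2)[OF bounded_Phi]
        bounded_opD(2)[OF that] Phi_in_E cinner_add_left)
  note fams = fam[OF bounded_coefficients(1)] fam[OF bounded_coefficients(2)] fam[OF bounded_coefficients(3)]
  have fam_m: "additive_family (\<lambda>i r. - s \<sigma>1 i r)"
    using fams(1) by (simp add: additive_family_def)
  have minus: "weighted_sum (\<lambda>i r. - s \<sigma> i r) Q = - weighted_sum (s \<sigma>) Q" for \<sigma> Q
    by (simp add: weighted_sum_def sum_negf)
  have bez_eq: "cinner (bez n (c10, c20, c12) (moment_vec n (act r k))) v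
      = weighted_sum (s \<gamma>in) (mC r * matrix_poly n c12) + weighted_sum (s \<sigma>1) (mC r * matrix_poly n c10)
        + weighted_sum (s \<sigma>2) (mC r * matrix_poly n c20)" for c10 c20 c12 r
    unfolding cinner_bezout_op_moment_vec weighted_sum_const_mult_matrix_poly[OF fams(1)]
      weighted_sum_const_mult_matrix_poly[OF fams(2)] weighted_sum_const_mult_matrix_poly[OF fams(3)]
    by (simp add: s_def sum.distrib B.act_mult B.act_commute[of r])
  obtain c10 c20 c12 where c: "bez10 = (c10, c20, c12)" by (cases bez10)
  obtain d10 d20 d12 where d: "bez20 = (d10, d20, d12)" by (cases bez20)
  obtain f10 f20 f12 where f: "bez12 = (f10, f20, f12)" by (cases bez12)
  let ?P0 = "mC (complex_poly p0)" and ?P1 = "mC (complex_poly p1)" and ?P2 = "mC (complex_poly p2)"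
  define Q where "Q f c d = ?P0 * matrix_poly n f - ?P2 * matrix_poly n c + ?P1 * matrix_poly n d" for f c d
  have keys_Q: "Poly_Mapping.keys (Q f c d) \<subseteq> multi_indices n" for f c d
    unfolding Q_def
    by (rule order_trans[OF keys_add] Un_least order_trans[OF keys_diff] keys_const_mult_matrix_poly)+
  have "weighted_sum (s \<gamma>in) (Q f12 c12 d12) + weighted_sum (s \<sigma>2) (Q f20 c20 d20)
    + weighted_sum (\<lambda>i r. - s \<sigma>1 i r) (- Q f10 c10 d10) = 0"
  proof (rule pairing_vanishes[where n = n and D = UNIV and D' = UNIV and ?y1.0 = mX1 and ?y2.0 = mX2])
    show "Q f12 c12 d12 * (mX1 * mY2 - mX2 * mY1) + Q f20 c20 d20 * (mX2 - mY2)
      + - Q f10 c10 d10 * (mY1 - mX1) = 0"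
    proof -
      let ?L = "\<lambda>b10 b20 b12. matrix_poly n b10 * (mX1 - mY1) + matrix_poly n b20 * (mX2 - mY2)
        + matrix_poly n b12 * (mX1 * mY2 - mX2 * mY1)"
      have "Q f12 c12 d12 * (mX1 * mY2 - mX2 * mY1) + Q f20 c20 d20 * (mX2 - mY2) + - Q f10 c10 d10 * (mY1 - mX1)
        = ?P0 * ?L f10 f20 f12 - ?P2 * ?L c10 c20 c12 + ?P1 * ?L d10 d20 d12"
        unfolding Q_def by (simp add: algebra_simps)
      also have "\<dots> = 0"
        unfolding bezout_polynomial_identity[OF b10[unfolded c]] bezout_polynomial_identity[OF b20[unfolded d]]
          bezout_polynomial_identity[OF b12[unfolded f]]
        by (simp add: algebra_simps)
      finally show ?thesis .
    qed
    fix a b and r :: "complex poly2"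
    show "s \<gamma>in (a, b) r + s \<sigma>2 (Suc a, b) r + - s \<sigma>1 (a, Suc b) r = 0" if "Suc (a + b) < n"
      using principal_relation_cinner[OF v that Phi_in_E] by (simp add: s_def)
    have "s \<gamma>in (a, b) r + s \<sigma>2 (a, b) (mX1 * r) + - s \<sigma>1 (a, b) (mX2 * r)
      = cinner (\<sigma>2 (\<Phi> (B1 (act r k))) - \<sigma>1 (\<Phi> (B2 (act r k))) + \<gamma>in (\<Phi> (act r k)))
          (Poly_Mapping.lookup v (a, b))"
      by (simp add: s_def B.act_mult B.act_X1 B.act_X2 cinner_simps
          del: input_condition)
    then show "s \<gamma>in (a, b) r + s \<sigma>2 (a, b) (mX1 * r) + - s \<sigma>1 (a, b) (mX2 * r) = 0"
      by (simp only: Phi_relation cinner_zero_left)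
  qed (simp_all add: keys_Q fams fam_m)
  then show ?thesis
    unfolding c d f bez_eq
    by (simp add: minus Q_def weighted_sum_diff weighted_sum_add fams weighted_sum_minus algebra_simps)
qed

section \<open>The transformed vessel\<close>

context
  fixes p0 :: "real poly2"
  assumes p0_invertible: "invertible_op (op_poly p0 A1 A2)"
begin

abbreviation "R \<equiv> inv (op_poly p0 A1 A2)"

lemma R_inverse: "op_poly p0 A1 A2 (R h) = h" "R (op_poly p0 A1 A2 h) = h"
  using p0_invertible
  by (simp_all add: invertible_op_def bij_is_surj surj_f_inv_f bij_is_inj inv_f_f)

lemma bounded_R: "bounded_op UNIV UNIV R"
  using p0_invertible by (simp add: invertible_op_def)

lemma cadjoint_R_inverse:
  "op_poly p0 B1 B2 (cadjoint R h) = h" "cadjoint R (op_poly p0 B1 B2 h) = h"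
proof -
  interpret A: commuting_operators A1 A2 by (rule commuting_operators_A)
  show "op_poly p0 B1 B2 (cadjoint R h) = h"
    by (rule cinner_extensional)
      (simp add: A.cinner_op_poly_cadjoint[symmetric] cinner_cadjoint[OF bounded_R, symmetric] R_inverse)
  show "cadjoint R (op_poly p0 B1 B2 h) = h"
    by (rule cinner_extensional)
      (simp add: A.cinner_op_poly_cadjoint[symmetric] cinner_cadjoint[OF bounded_R, symmetric] R_inverse)
qed

lemma inv_op_poly_cadjoint: "inv (op_poly p0 B1 B2) = cadjoint R"
  by (rule inv_equality) (rule cadjoint_R_inverse)+

lemma bij_op_poly_cadjoint: "bij (op_poly p0 B1 B2)"
  by (rule o_bij[of "cadjoint R"]) (simp_all add: fun_eq_iff cadjoint_R_inverse)

lemma cadjoint_op_rat: "cadjoint (op_rat p p0 A1 A2) h = cadjoint R (op_poly p B1 B2 h)"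
proof (rule cadjoint_apply_eqI)
  interpret A: commuting_operators A1 A2 by (rule commuting_operators_A)
  interpret B: commuting_operators B1 B2 by (rule commuting_operators_B)
  have "cadjoint R (op_poly p B1 B2 h) = op_poly p B1 B2 (cadjoint R h)"
    using B.act_inverse_commute[of "complex_poly p0" "complex_poly p"] bij_op_poly_cadjoint
    unfolding op_poly_eq_poly_action[symmetric] inv_op_poly_cadjoint by blast
  then show "cinner (op_rat p p0 A1 A2 x) h = cinner x (cadjoint R (op_poly p B1 B2 h))" for x
    by (simp add: op_rat_def cinner_cadjoint[OF bounded_R] A.cinner_op_poly_cadjoint)
qed

lemma bounded_op_rat: "bounded_op UNIV UNIV (op_rat p p0 A1 A2)"
proof -
  interpret A: commuting_operators A1 A2 by (rule commuting_operators_A)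
  show ?thesis
    unfolding op_rat_def comp_def
    using bounded_op_comp[OF A.bounded_act bounded_R, of "complex_poly p"]
    by (simp add: op_poly_eq_poly_action)
qed

lemma op_rat_commute: "op_rat p p0 A1 A2 \<circ> op_rat q p0 A1 A2 = op_rat q p0 A1 A2 \<circ> op_rat p p0 A1 A2"
proof -
  interpret A: commuting_operators A1 A2 by (rule commuting_operators_A)
  have "bij (op_poly p0 A1 A2)"
    using p0_invertible by (simp add: invertible_op_def)
  then have "R (op_poly p A1 A2 h) = op_poly p A1 A2 (R h)" for p h
    unfolding op_poly_eq_poly_action by (rule A.act_inverse_commute)
  moreover have "op_poly p A1 A2 (op_poly q A1 A2 h) = op_poly q A1 A2 (op_poly p A1 A2 h)" for h
    unfolding op_poly_eq_poly_action by (rule A.act_commute)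
  ultimately show ?thesis
    by (simp add: op_rat_def fun_eq_iff)
qed

lemma transformed_Phi_eq:
  "transformed_Phi n p0 A1 A2 \<Phi> E \<sigma>1 \<sigma>2 \<gamma>in h = moment_vec n (cadjoint R h)"
proof -
  have "transformed_Phi n p0 A1 A2 \<Phi> E \<sigma>1 \<sigma>2 \<gamma>in h = orth_proj (V n) (moment_vec n (cadjoint R h))"
    by (simp add: transformed_Phi_def moment_vec_def inv_op_poly_cadjoint)
  then show ?thesis
    by (simp add: orth_proj_ident[OF fin_dim_principal moment_vec_principal])
qed

lemma bounded_transformed_Phi:
  "bounded_op UNIV (V n) (transformed_Phi n p0 A1 A2 \<Phi> E \<sigma>1 \<sigma>2 \<gamma>in)"
  unfolding transformed_Phi_eq[abs_def]
  by (rule bounded_op_comp[OF bounded_op_cadjoint[OF bounded_R] bounded_moment_vec])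

lemma transformed_colligation:
  assumes b: "is_bezout n (homogenize n p) (homogenize n p0) b"
  defines "\<Phi>' \<equiv> transformed_Phi n p0 A1 A2 \<Phi> E \<sigma>1 \<sigma>2 \<gamma>in"
  shows "cadjoint \<Phi>' (compressed_bezout_op n E \<sigma>1 \<sigma>2 \<gamma>in b (\<Phi>' h))
    = (1 / \<i>) *\<^sub>C (op_rat p p0 A1 A2 h - cadjoint (op_rat p p0 A1 A2) h)"
proof (rule cinner_extensional)
  fix g
  interpret A: commuting_operators A1 A2 by (rule commuting_operators_A)
  interpret B: commuting_operators B1 B2 by (rule commuting_operators_B)
  note bdd = bounded_transformed_Phi[of n, folded \<Phi>'_def]
  have adj: "op_poly p B1 B2 (cadjoint R x) = cadjoint (op_rat p p0 A1 A2) x" for x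
    using B.act_inverse_commute[of "complex_poly p0" "complex_poly p"] bij_op_poly_cadjoint
    unfolding op_poly_eq_poly_action[symmetric] inv_op_poly_cadjoint cadjoint_op_rat by simp
  have "cinner (compressed_bezout_op n E \<sigma>1 \<sigma>2 \<gamma>in b (\<Phi>' h)) (\<Phi>' g)
      = (1 / \<i>) * (cinner h (cadjoint (op_rat p p0 A1 A2) g) - cinner (cadjoint (op_rat p p0 A1 A2) h) g)"
    unfolding \<Phi>'_def transformed_Phi_eq
    by (simp add: cinner_compressed_bezout_op moment_vec_principal cinner_bezout_op_moment_vecs[OF b]
        op_poly_eq_poly_action[symmetric] cadjoint_R_inverse adj)
  also have "\<dots> = cinner ((1 / \<i>) *\<^sub>C (op_rat p p0 A1 A2 h - cadjoint (op_rat p p0 A1 A2) h)) g"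
    by (simp only: cinner_scaleC_left cinner_diff_left cinner_cadjoint[OF bounded_op_rat])
  finally have "cinner (cadjoint \<Phi>' (compressed_bezout_op n E \<sigma>1 \<sigma>2 \<gamma>in b (\<Phi>' h))) g
    = cinner ((1 / \<i>) *\<^sub>C (op_rat p p0 A1 A2 h - cadjoint (op_rat p p0 A1 A2) h)) g"
    by (simp only: cinner_cadjoint_left[OF bdd])
  then show "cinner g (cadjoint \<Phi>' (compressed_bezout_op n E \<sigma>1 \<sigma>2 \<gamma>in b (\<Phi>' h)))
    = cinner g ((1 / \<i>) *\<^sub>C (op_rat p p0 A1 A2 h - cadjoint (op_rat p p0 A1 A2) h))"
    unfolding cinner_commute[of g] by simp
qed

text \<open>
  All three terms are moment vectors of polynomials in \<open>B\<close> applied to the common vector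
  \<open>k = p\<^sub>0(B)\<^sup>-\<^sup>2 h\<close>.
\<close>

lemma transformed_input_condition:
  assumes b10: "is_bezout n (homogenize n p1) (homogenize n p0) bez10"
    and b20: "is_bezout n (homogenize n p2) (homogenize n p0) bez20"
    and b12: "is_bezout n (homogenize n p1) (homogenize n p2) bez12"
  defines "\<Phi>' \<equiv> transformed_Phi n p0 A1 A2 \<Phi> E \<sigma>1 \<sigma>2 \<gamma>in"
    and "C \<equiv> compressed_bezout_op n E \<sigma>1 \<sigma>2 \<gamma>in"
  shows "C bez12 (\<Phi>' h) = C bez10 (\<Phi>' (cadjoint (op_rat p2 p0 A1 A2) h))
    - C bez20 (\<Phi>' (cadjoint (op_rat p1 p0 A1 A2) h))"
proof (rule cinner_extensional_subspace[OF fin_dim_principal[of n]])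
  interpret B: commuting_operators B1 B2 by (rule commuting_operators_B)
  note CV = bounded_opD(1)[OF bounded_compressed_bezout_op, of _ n, folded C_def]
  have \<Phi>'V: "\<Phi>' x \<in> V n" for x
    unfolding \<Phi>'_def transformed_Phi_eq by (rule moment_vec_principal)
  show "C bez12 (\<Phi>' h) \<in> V n"
    by (rule CV[OF \<Phi>'V])
  show "C bez10 (\<Phi>' (cadjoint (op_rat p2 p0 A1 A2) h)) - C bez20 (\<Phi>' (cadjoint (op_rat p1 p0 A1 A2) h)) \<in> V n"
    by (intro complex_vector.subspace_diff[OF subspace_principal] CV \<Phi>'V)
  fix v assume v: "v \<in> V n"
  define k where "k = cadjoint R (cadjoint R h)"
  have commute_R: "cadjoint R (op_poly p B1 B2 x) = op_poly p B1 B2 (cadjoint R x)" for p x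
    using B.act_inverse_commute[of "complex_poly p0" "complex_poly p"] bij_op_poly_cadjoint
    unfolding op_poly_eq_poly_action[symmetric] inv_op_poly_cadjoint by simp
  have k0: "cadjoint R h = act (complex_poly p0) k"
    unfolding k_def op_poly_eq_poly_action[symmetric] cadjoint_R_inverse ..
  have kp: "cadjoint R (cadjoint (op_rat p p0 A1 A2) h) = act (complex_poly p) k" for p
    unfolding k_def op_poly_eq_poly_action[symmetric] cadjoint_op_rat commute_R ..
  have "cinner (C bez12 (\<Phi>' h)) v = cinner (C bez10 (\<Phi>' (cadjoint (op_rat p2 p0 A1 A2) h))) v
    - cinner (C bez20 (\<Phi>' (cadjoint (op_rat p1 p0 A1 A2) h))) v"
    unfolding C_def \<Phi>'_def transformed_Phi_eq k0 kp
      cinner_compressed_bezout_op[OF moment_vec_principal v]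
    by (rule input_condition_moment_vec[OF b10 b20 b12 v])
  then show "cinner (C bez12 (\<Phi>' h)) v = cinner (C bez10 (\<Phi>' (cadjoint (op_rat p2 p0 A1 A2) h))
    - C bez20 (\<Phi>' (cadjoint (op_rat p1 p0 A1 A2) h))) v"
    by (simp only: cinner_diff_left)
qed

end

end

theorem theorem3p1:
  fixes A1 A2 :: "'h::complex_hilbert \<Rightarrow> 'h"
    and \<Phi> :: "'h \<Rightarrow> 'e::complex_inner"
    and E :: "'e set"
    and \<sigma>1 \<sigma>2 \<gamma>in \<gamma>out :: "'e \<Rightarrow> 'e"
    and e :: "'m::finite \<Rightarrow> 'e"
    and p0 p1 p2 :: "real poly2"
    and n :: nat
    and bez10 bez20 bez12 :: bezout_triple
  assumes vessel: "commutative_vessel A1 A2 \<Phi> E \<sigma>1 \<sigma>2 \<gamma>in \<gamma>out"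
    and basis: "orthonormal_basis_of E e"
    and irreducible_affine: "irreducible (discriminant e \<sigma>1 \<sigma>2 \<gamma>in)"
    and irreducible_hom: "irreducible (hom_discriminant e \<sigma>1 \<sigma>2 \<gamma>in)"
    and p0_nonzero: "p0 \<noteq> 0"
    and p0_invertible: "invertible_op (op_poly p0 A1 A2)"
    and n_def: "n = Max {total_degree p0, total_degree p1, total_degree p2}"
    and bezout_10: "is_bezout n (homogenize n p1) (homogenize n p0) bez10"
    and bezout_20: "is_bezout n (homogenize n p2) (homogenize n p0) bez20"
    and bezout_12: "is_bezout n (homogenize n p1) (homogenize n p2) bez12"
  defines "E' \<equiv> principal_subspace n E \<sigma>1 \<sigma>2 \<gamma>in"
    and "\<Phi>' \<equiv> transformed_Phi n p0 A1 A2 \<Phi> E \<sigma>1 \<sigma>2 \<gamma>in"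
    and "\<sigma>1' \<equiv> compressed_bezout_op n E \<sigma>1 \<sigma>2 \<gamma>in bez10"
    and "\<sigma>2' \<equiv> compressed_bezout_op n E \<sigma>1 \<sigma>2 \<gamma>in bez20"
    and "\<gamma>in' \<equiv> compressed_bezout_op n E \<sigma>1 \<sigma>2 \<gamma>in bez12"
  shows "commutative_vessel (op_rat p1 p0 A1 A2) (op_rat p2 p0 A1 A2)
           \<Phi>' E' \<sigma>1' \<sigma>2' \<gamma>in' (transformed_gamma_out \<Phi>' \<sigma>1' \<sigma>2' \<gamma>in')"
proof -
  interpret commutative_vessel A1 A2 \<Phi> E \<sigma>1 \<sigma>2 \<gamma>in \<gamma>out
    by (rule vessel)
  note inv = p0_invertible
  show ?thesis
    unfolding E'_def \<Phi>'_def \<sigma>1'_def \<sigma>2'_def \<gamma>in'_def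
    by (rule commutative_vessel_transformed_gamma_out)
      (rule bounded_op_rat[OF inv] op_rat_commute[OF inv] fin_dim_principal bounded_transformed_Phi[OF inv]
        selfadjoint_compressed_bezout_op[OF bezout_10] selfadjoint_compressed_bezout_op[OF bezout_20]
        selfadjoint_compressed_bezout_op[OF bezout_12] transformed_colligation[OF inv bezout_10]
        transformed_colligation[OF inv bezout_20]
        transformed_input_condition[OF inv bezout_10 bezout_20 bezout_12])+
qed

end
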